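(* Let $\mathbb{K}$ be a field with characteristic different from $2$, let $\alpha \in \mathbb{K}\setminus\{0\}$, let $E$ be a vector space over $\mathbb{K}$ of finite dimension $n \geq 1$, and let $u$ be an endomorphism of $E$. Then $u$ is an $(\alpha,-\alpha)$-composite (in $\operatorname{End}(E)$) if and only if all the following conditions hold: (i) The sequences $(n_k(u,\alpha))_{k \geq 1}$ and $(n_k(u,-\alpha))_{k \geq 1}$ are intertwined. (ii) The elementary factors of $u_{-\{0,\alpha,-\alpha\}}$ are all even polynomials (i.e. polynomials of $X^2$).
   Context: For scalars $a,b \in \mathbb{K}\setminus\{0\}$, an element $x$ of a $\mathbb{K}$-algebra $\mathcal{A}$ is an $(a,b)$-composite if there are idempotents $p,q \in \mathcal{A}$ (i.e. $p^2=p$, $q^2=q$) with $x = a p + b q$. For $u\in\operatorname{End}(E)$, $\lambda\in\mathbb{K}$ and an integer $k\geq 1$, $n_k(u,\lambda) := \dim \operatorname{Ker}(u-\lambda\,\mathrm{id}_E)^k - \dim\operatorname{Ker}(u-\lambda\,\mathrm{id}_E)^{k-1}$. Two sequences $(u_k)_{k\geq 1}$ and $(v_k)_{k\geq 1}$ are intertwined if for all $k \geq 1$: $v_{k+1} \leq u_k$ and $u_{k+1} \leq v_k$. For a subset $\Lambda\subset\mathbb{K}$, write the minimal polynomial of $u$ as $\mu_u = P Q$ with $P$ a product of (possibly repeated) factors $X-\lambda$, $\lambda\in\Lambda$, and $Q$ monic with no root in $\Lambda$; then $u_{-\Lambda}$ denotes the endomorphism of $\operatorname{Ker} Q(u)$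 induced by $u$. The elementary factors of an endomorphism (or square matrix) are its invariant factors: the nonconstant monic polynomials $P_1 \mid P_2 \mid \dots \mid P_N$ in $\mathbb{K}[X]$ such that it is represented by (similar to) the block-diagonal matrix of the companion matrices of $P_1,\dots,P_N$ (there are none if the space is zero). A polynomial of $R$ (with $R\in\mathbb{K}[X]$) is a polynomial of the form $S(R)$ with $S\in\mathbb{K}[X]$. *)

theory Defs
  imports
    "HOL-Computational_Algebra.Polynomial"
    "Jordan_Normal_Form.Matrix"
begin

definition polynomial_of :: "'a::comm_semiring_1 poly \<Rightarrow> 'a poly \<Rightarrow> bool" where
  "polynomial_of R P \<longleftrightarrow> (\<exists>S. P = pcompose S R)"

definition even_poly :: "'a::comm_semiring_1 poly \<Rightarrow> bool" where
  "even_poly P \<longleftrightarrow> polynomial_of (monom 1 2) P"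

definition intertwined :: "(nat \<Rightarrow> int) \<Rightarrow> (nat \<Rightarrow> int) \<Rightarrow> bool" where
  "intertwined s t \<longleftrightarrow> (\<forall>k\<ge>1. t (k + 1) \<le> s k \<and> s (k + 1) \<le> t k)"

(* Convention: ones on the subdiagonal, negated coefficients in the last column. *)
definition companion_mat :: "'a::comm_ring_1 poly \<Rightarrow> 'a mat" where
  "companion_mat P =
    (let d = degree P in
     mat d d (\<lambda>(i, j). if j = d - 1 then - coeff P i else if i = j + 1 then 1 else 0))"

(* The unique Q with P = (product of factors X - l, l in L) * Q, Q monic without root in L,
   for a monic P. *)
definition rootless_part :: "'a::field set \<Rightarrow> 'a poly \<Rightarrow> 'a poly" where
  "rootless_part L P =
    (THE Q. lead_coeff Q = 1 \<and> (\<forall>l\<in>L. poly Q l \<noteq> 0) \<and>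
       (\<exists>ls. set ls \<subseteq> L \<and> P = (\<Prod>l\<leftarrow>ls. [:- l, 1:]) * Q))"

definition composite ::
  "('a::field \<Rightarrow> 'b::ab_group_add \<Rightarrow> 'b) \<Rightarrow> 'a \<Rightarrow> 'a \<Rightarrow> ('b \<Rightarrow> 'b) \<Rightarrow> bool" where
  "composite scale a b u \<longleftrightarrow>
    (\<exists>p q. Vector_Spaces.linear scale scale p \<and> Vector_Spaces.linear scale scale q \<and>
       p \<circ> p = p \<and> q \<circ> q = q \<and> u = (\<lambda>x. scale a (p x) + scale b (q x)))"

definition poly_endo ::
  "('a::field \<Rightarrow> 'b::ab_group_add \<Rightarrow> 'b) \<Rightarrow> 'a poly \<Rightarrow> ('b \<Rightarrow> 'b) \<Rightarrow> 'b \<Rightarrow> 'b" where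
  "poly_endo scale P u x = (\<Sum>i\<le>degree P. scale (coeff P i) ((u ^^ i) x))"

definition kernel :: "('b::zero \<Rightarrow> 'b) \<Rightarrow> 'b set" where
  "kernel f = {x. f x = 0}"

definition n_seq ::
  "('a::field \<Rightarrow> 'b::ab_group_add \<Rightarrow> 'b) \<Rightarrow> ('b \<Rightarrow> 'b) \<Rightarrow> 'a \<Rightarrow> nat \<Rightarrow> int" where
  "n_seq scale u l k =
    int (vector_space.dim scale (kernel ((\<lambda>x. u x - scale l x) ^^ k))) -
    int (vector_space.dim scale (kernel ((\<lambda>x. u x - scale l x) ^^ (k - 1))))"

definition min_poly ::
  "('a::field \<Rightarrow> 'b::ab_group_add \<Rightarrow> 'b) \<Rightarrow> ('b \<Rightarrow> 'b) \<Rightarrow> 'a poly" where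
  "min_poly scale u =
    (THE P. lead_coeff P = 1 \<and> (\<forall>x. poly_endo scale P u x = 0) \<and>
       (\<forall>R. (\<forall>x. poly_endo scale R u x = 0) \<longrightarrow> P dvd R))"

(* The u-invariant subspace Ker Q(u) on which u induces the endomorphism u_{-L}. *)
definition off_space ::
  "('a::field \<Rightarrow> 'b::ab_group_add \<Rightarrow> 'b) \<Rightarrow> ('b \<Rightarrow> 'b) \<Rightarrow> 'a set \<Rightarrow> 'b set" where
  "off_space scale u L = kernel (poly_endo scale (rootless_part L (min_poly scale u)) u)"

(* M is the matrix, in some ordered basis of W, of the endomorphism of W induced by u. *)
definition represented_on ::
  "('a::field \<Rightarrow> 'b::ab_group_add \<Rightarrow> 'b) \<Rightarrow> 'b set \<Rightarrow> ('b \<Rightarrow> 'b) \<Rightarrow> 'a mat \<Rightarrow> bool" where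
  "represented_on scale W u M \<longleftrightarrow>
    (\<exists>bs. distinct bs \<and> \<not> module.dependent scale (set bs) \<and> module.span scale (set bs) = W \<and>
       M \<in> carrier_mat (length bs) (length bs) \<and>
       (\<forall>j<length bs. u (bs ! j) = (\<Sum>i<length bs. scale (M $$ (i, j)) (bs ! i))))"

(* Ps is the list of invariant factors of the endomorphism of W induced by u. *)
definition elementary_factors_on ::
  "('a::field \<Rightarrow> 'b::ab_group_add \<Rightarrow> 'b) \<Rightarrow> 'b set \<Rightarrow> ('b \<Rightarrow> 'b) \<Rightarrow> 'a poly list \<Rightarrow> bool" where
  "elementary_factors_on scale W u Ps \<longleftrightarrow>
    (\<forall>P\<in>set Ps. lead_coeff P = 1 \<and> degree P > 0) \<and> sorted_wrt (dvd) Ps \<and>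
    represented_on scale W u (diag_block_mat (map companion_mat Ps))"

end

theory Submission
  imports Defs "HOL-Computational_Algebra.Polynomial_Factorial"
begin

text \<open>
Write \<open>a\<close> for the scalar. To a pair of idempotents \<open>p, q\<close> with \<open>u = a p - a q\<close> belongs the map
\<open>s = a (p + q - 1)\<close>, and a short computation gives \<open>s u = - u s\<close> and \<open>s\<^sup>2 = a\<^sup>2 - u\<^sup>2\<close>. Conversely,
as \<open>2 a\<close> is invertible, such an \<open>s\<close> returns the idempotents \<open>(a + s + u) / (2 a)\<close> and
\<open>(a + s - u) / (2 a)\<close> (\<open>composite_iff_anticommuting_root\<close>). So the question is when there is
an \<open>s\<close> that anticommutes with \<open>u\<close> and has the square \<open>a\<^sup>2 - u\<^sup>2\<close>. Such an \<open>s\<close> maps \<open>Ker (u - a)\<^sup>k\<close> to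
\<open>Ker (u + a)\<^sup>k\<close> and back, and leaves invariant \<open>Ker u\<^sup>k\<close> and the kernel \<open>F\<close> of the rootless part \<open>Q(u)\<close>
of the minimal polynomial. Conversely the pieces of \<open>s\<close> can be chosen separately on the
summands \<open>Ker u\<^sup>N\<close>, \<open>F\<close> and \<open>Ker (u - a)\<^sup>N \<oplus> Ker (u + a)\<^sup>N\<close> of the space.

On \<open>F\<close> the operator \<open>a + u\<close> is invertible, and \<open>s = (a + u) j\<close> translates the two conditions into
\<open>j\<^sup>2 = 1\<close> and \<open>j u = - u j\<close>. In other words \<open>F\<close> is a sum of the eigenspaces \<open>A, B\<close> of \<open>j\<close>, and \<open>u\<close>
exchanges them. If \<open>j\<close> is given, a decomposition of \<open>A\<close> into cyclic subspaces of \<open>u\<^sup>2\<close> with invariant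
factors \<open>P\<^sub>i\<close> generates one of \<open>F = A \<oplus> u A\<close> into cyclic subspaces of \<open>u\<close> with the invariant factors
\<open>P\<^sub>i(X\<^sup>2)\<close> (\<open>cyclic_decomposition_square_lift\<close>, \<open>even_elementary_factors\<close>). If
conversely all factors are even, then alternating signs on the basis vectors
\<open>e, u e, u\<^sup>2 e, \<dots>\<close> of each companion block define \<open>j\<close> (\<open>parity_involution\<close>). The same signs work for the
blocks \<open>X\<^sup>m\<close> of the nilpotent part, so \<open>Ker u\<^sup>N\<close> imposes no condition.

On \<open>Ker (u - a)\<^sup>N \<oplus> Ker (u + a)\<^sup>N\<close> the two components of \<open>s\<close> have the composites \<open>-(u - a)(u + a)\<close>,
which are the nilpotent parts of \<open>u\<close> up to invertible factors. Together the two components descend by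
just one step of the kernel filtration, which forces the two sequences of jumps to be intertwined
(\<open>anticommuting_root_ker_jump_le\<close>). Conversely, intertwined sequences allow the Jordan blocks for \<open>a\<close>
and \<open>- a\<close> to be paired, the longest with the longest, so that the sizes in each pair differ by at most
one; for such a pair \<open>s\<close> can be written down (\<open>anticommuting_root_cyclic_pair\<close>,
\<open>anticommuting_root_intertwined\<close>).
\<close>

section \<open>Polynomials over a field\<close>

text \<open>
Coprimality in Bezout form, which is the form in which it is applied to operators.
\<close>

definition comaximal :: "'a::comm_ring_1 \<Rightarrow> 'a \<Rightarrow> bool" where
  "comaximal a b \<longleftrightarrow> (\<exists>r s. r * a + s * b = 1)"

lemma comaximal_sym: "comaximal a b \<Longrightarrow> comaximal b a"
  unfolding comaximal_def by (metis add.commute)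

lemma comaximal_1: "comaximal a 1"
  unfolding comaximal_def by (intro exI[of _ 0] exI[of _ 1]) simp

lemma comaximal_mult:
  assumes "comaximal a b" "comaximal a c"
  shows "comaximal a (b * c)"
proof -
  obtain r s where 1: "r * a + s * b = 1" using assms(1) unfolding comaximal_def by blast
  obtain r' s' where 2: "r' * a + s' * c = 1" using assms(2) unfolding comaximal_def by blast
  have "(r * a + s * b) * (r' * a + s' * c) = 1" by (simp add: 1 2)
  then have "(r * (r' * a + s' * c) + s * b * r') * a + (s * s') * (b * c) = 1"
    by (simp add: algebra_simps)
  then show ?thesis unfolding comaximal_def by blast
qed

lemma comaximal_power:
  assumes "comaximal a b" shows "comaximal (a ^ m) (b ^ n)"
proof -
  have 1: "comaximal a (b ^ n)" for n
    by (induction n) (simp_all add: comaximal_1 comaximal_mult assms)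
  have "comaximal (b ^ n) (a ^ m)"
    by (induction m) (simp_all add: comaximal_1 comaximal_mult comaximal_sym[OF 1])
  then show ?thesis by (rule comaximal_sym)
qed

lemma comaximal_dvd_mult:
  assumes "comaximal a b" "a dvd b * c" shows "a dvd c"
proof -
  obtain r s where 1: "r * a + s * b = 1" using assms(1) unfolding comaximal_def by blast
  have c: "c = (r * c) * a + s * (b * c)" using arg_cong[OF 1, of "\<lambda>x. x * c"] by (simp add: algebra_simps)
  have "a dvd (r * c) * a + s * (b * c)" by (rule dvd_add[OF dvd_triv_right dvd_mult[OF assms(2)]])
  then show ?thesis unfolding c[symmetric] .
qed

lemma comaximal_mult_dvd:
  assumes "comaximal a b" "a dvd c" "b dvd c" shows "a * b dvd c"
proof -
  obtain d where d: "c = b * d" using assms(3) by blast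
  then have "a dvd d" using assms comaximal_dvd_mult by blast
  then have "b * a dvd b * d" by (intro mult_dvd_mono) simp_all
  then show ?thesis by (simp only: d mult.commute[of a b])
qed

lemma comaximal_linear_if_no_root:
  fixes Q :: "'a::field poly"
  assumes "poly Q l \<noteq> 0" shows "comaximal [:- l, 1:] Q"
proof -
  have "[:- l, 1:] dvd Q - [:poly Q l:]" by (simp add: poly_eq_0_iff_dvd[symmetric])
  then obtain R where R: "Q - [:poly Q l:] = [:- l, 1:] * R" by blast
  have "[:inverse (poly Q l):] * (Q - [:- l, 1:] * R) = 1"
    unfolding R[symmetric] using assms by (simp add: one_pCons)
  then have "(- [:inverse (poly Q l):] * R) * [:- l, 1:] + [:inverse (poly Q l):] * Q = 1"
    by (simp only: algebra_simps) (simp add: algebra_simps)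
  then show ?thesis unfolding comaximal_def by blast
qed

text \<open>
An element of least degree divides all others, by division with remainder. Annihilators of vectors,
the minimal polynomial and Bezout identities all come from this generator.
\<close>

lemma poly_ideal_principal:
  fixes I :: "'a::field poly set"
  assumes "f0 \<in> I" "f0 \<noteq> 0"
    and add: "\<And>f g. f \<in> I \<Longrightarrow> g \<in> I \<Longrightarrow> f + g \<in> I"
    and mult: "\<And>f r. f \<in> I \<Longrightarrow> r * f \<in> I"
  shows "\<exists>g. g \<in> I \<and> lead_coeff g = 1 \<and> (\<forall>f. f \<in> I \<longleftrightarrow> g dvd f)"
proof -
  obtain g where g: "g \<in> I" "g \<noteq> 0" "\<And>h. h \<in> I \<Longrightarrow> h \<noteq> 0 \<Longrightarrow> degree g \<le> degree h"
    using ex_has_least_nat[of "\<lambda>h. h \<in> I \<and> h \<noteq> 0" f0 degree] assms(1,2) by blast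
  let ?g = "[:inverse (lead_coeff g):] * g"
  have "f \<in> I \<longleftrightarrow> ?g dvd f" for f
  proof
    assume f: "f \<in> I"
    have "f mod g = f + (- (f div g)) * g" by (simp add: minus_div_mult_eq_mod[symmetric])
    then have "f mod g \<in> I" using f g(1) add mult by metis
    moreover have "f mod g = 0 \<or> degree (f mod g) < degree g" using g(2) by (metis degree_mod_less)
    ultimately have "f mod g = 0" using g(3) by fastforce
    then show "?g dvd f" using g(2) by (simp add: dvd_eq_mod_eq_0[symmetric] smult_dvd_iff)
  next
    assume "?g dvd f" then show "f \<in> I" by (metis g(1) mult dvdE mult.commute)
  qed
  moreover have "?g \<in> I" using g mult by blast
  moreover have "lead_coeff ?g = 1" using g(2) by simp
  ultimately show ?thesis by blast
qed

lemma monic_dvd_antisym: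
  fixes p q :: "'a::field poly"
  assumes "p dvd q" "q dvd p" "lead_coeff p = 1" "lead_coeff q = 1"
  shows "p = q"
proof -
  obtain c where c: "q = p * c" using assms(1) by blast
  have nz: "p \<noteq> 0" "q \<noteq> 0" using assms by auto
  then have "degree p = degree q" using assms(1,2) by (meson dvd_imp_degree_le order_antisym)
  then have "degree c = 0" using c nz by (auto simp: degree_mult_eq)
  then obtain k where "c = [:k:]" by (auto elim: degree_eq_zeroE)
  moreover have "lead_coeff q = lead_coeff p * lead_coeff c" unfolding c by (rule lead_coeff_mult)
  ultimately show ?thesis using assms(3,4) c by auto
qed

lemma prime_comaximal:
  fixes p f :: "'a::field poly"
  assumes p: "prime_elem p" and "\<not> p dvd f" shows "comaximal p f"
proof -
  let ?I = "{r * p + s * f | r s. True}"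
  have "p \<in> ?I" "f \<in> ?I" by (force intro: exI[of _ 0] exI[of _ 1])+
  moreover have "p \<noteq> 0" using p by auto
  moreover have "a + b \<in> ?I" if in_I: "a \<in> ?I" "b \<in> ?I" for a b
  proof -
    obtain r s r' s' where "a = r * p + s * f" "b = r' * p + s' * f" using in_I by blast
    then have "a + b = (r + r') * p + (s + s') * f" by (simp add: algebra_simps)
    then show ?thesis by blast
  qed
  moreover have "c * a \<in> ?I" if in_I: "a \<in> ?I" for a c
  proof -
    obtain r s where "a = r * p + s * f" using in_I by blast
    then have "c * a = (c * r) * p + (c * s) * f" by (simp add: algebra_simps)
    then show ?thesis by blast
  qed
  ultimately obtain g where g: "g \<in> ?I" "\<And>h. h \<in> ?I \<longleftrightarrow> g dvd h"
    using poly_ideal_principal[of p ?I] by blast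
  have "g dvd p" "g dvd f" using g(2) \<open>p \<in> ?I\<close> \<open>f \<in> ?I\<close> by blast+
  then obtain h where h: "p = g * h" by blast
  have "\<not> p dvd g" using \<open>g dvd f\<close> assms(2) dvd_trans by blast
  moreover have "p dvd g * h" unfolding h[symmetric] by (rule dvd_refl)
  ultimately have "p dvd h" using prime_elem_dvd_multD[OF p] by blast
  then obtain k where "h = p * k" by blast
  with h have "p * (g * k) = p * 1" by (simp add: algebra_simps)
  then have "g * k = 1" unfolding mult_left_cancel[OF \<open>p \<noteq> 0\<close>] .
  then have "1 \<in> ?I" using g(2)[of 1] dvd_triv_left[of g k] by simp
  then show ?thesis unfolding comaximal_def by force
qed

lemma exists_prime_factor:
  fixes B :: "'a::field poly"
  assumes "degree B > 0" shows "\<exists>p. prime_elem p \<and> p dvd B"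
proof -
  obtain p where p: "p dvd B" "degree p > 0"
    "\<And>h. h dvd B \<Longrightarrow> degree h > 0 \<Longrightarrow> degree p \<le> degree h"
    using ex_has_least_nat[of "\<lambda>h. h dvd B \<and> degree h > 0" B degree] assms by auto
  have nz: "p \<noteq> 0" using p(2) by auto
  have "irreducible p"
  proof (rule irreducibleI)
    show "p \<noteq> 0" by (rule nz)
    show "\<not> p dvd 1" using p(2) nz by (simp add: is_unit_iff_degree)
    fix a b assume ab: "p = a * b"
    then have nz': "a \<noteq> 0" "b \<noteq> 0" using nz by auto
    then have d: "degree p = degree a + degree b" by (simp add: ab degree_mult_eq)
    have "degree a = 0 \<or> degree b = 0"
    proof (rule ccontr)
      assume "\<not> ?thesis"
      then have "degree a > 0" "degree b > 0" by auto
      moreover have "a dvd B" using ab p(1) by (metis dvd_mult_left)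
      ultimately show False using p(3)[of a] d by linarith
    qed
    then show "a dvd 1 \<or> b dvd 1" using nz' by (simp add: is_unit_iff_degree)
  qed
  then show ?thesis using p(1) field_poly_irreducible_imp_prime by blast
qed

text \<open>
Divisibility can be tested on prime powers. A prime factor of \<open>B\<close> that also divides \<open>A\<close> is cancelled
from both, and a witness for the quotients is raised by one if it belongs to the cancelled prime.
\<close>

lemma not_dvd_prime_power:
  fixes A B :: "'a::field poly"
  assumes "A \<noteq> 0" "B \<noteq> 0" "\<not> B dvd A"
  shows "\<exists>p k. prime_elem p \<and> p ^ k dvd B \<and> \<not> p ^ k dvd A"
  using assms
proof (induction "degree B" arbitrary: A B rule: less_induct)
  case less
  have "degree B > 0" using less.prems is_unit_iff_degree unit_imp_dvd by blast
  then obtain p where p: "prime_elem p" "p dvd B" using exists_prime_factor by blast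
  then have pd: "degree p > 0"
    using is_unit_iff_degree[of p] by (auto simp: prime_elem_def)
  show ?case
  proof (cases "p dvd A")
    case False
    then show ?thesis using p by (intro exI[of _ p] exI[of _ 1]) simp
  next
    case True
    obtain A1 where A1: "A = p * A1" using True by blast
    obtain B1 where B1: "B = p * B1" using p(2) by blast
    have nz: "p \<noteq> 0" "A1 \<noteq> 0" "B1 \<noteq> 0" using A1 B1 less.prems by auto
    have "degree B1 < degree B" using B1 nz pd by (simp add: degree_mult_eq)
    moreover have "\<not> B1 dvd A1" using less.prems(3) A1 B1 by (simp add: mult_dvd_mono)
    ultimately obtain q k where q: "prime_elem q" "q ^ k dvd B1" "\<not> q ^ k dvd A1"
      using less.hyps nz by blast
    show ?thesis
    proof (cases "q dvd p")
      case False
      then have "comaximal (q ^ k) p" using comaximal_power[OF prime_comaximal[OF q(1) False], of k 1] by simp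
      then have "\<not> q ^ k dvd A" using q(3) A1 comaximal_dvd_mult by blast
      moreover have "q ^ k dvd B" using q(2) B1 by simp
      ultimately show ?thesis using q(1) by blast
    next
      case True
      then obtain c where c: "p = q * c" by blast
      have "p dvd q"
      proof (rule ccontr)
        assume "\<not> p dvd q"
        have "p dvd q * c" unfolding c[symmetric] by (rule dvd_refl)
        then have "p dvd c" using prime_elem_dvd_multD[OF p(1)] \<open>\<not> p dvd q\<close> by blast
        then obtain d where "c = p * d" by blast
        with c have "p * (q * d) = p * 1" by (simp add: algebra_simps)
        then have "q * d = 1" unfolding mult_left_cancel[OF nz(1)] .
        then show False using q(1) dvd_triv_left[of q d] by (auto simp: prime_elem_def)
      qed
      have "q * q ^ k dvd B" unfolding B1 using True q(2) by (rule mult_dvd_mono)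
      moreover have "\<not> q * q ^ k dvd A"
      proof
        assume "q * q ^ k dvd A"
        then obtain e where e: "p * A1 = q * q ^ k * e" using A1 by blast
        obtain d where d: "q = p * d" using \<open>p dvd q\<close> by blast
        have "p * A1 = p * (d * q ^ k * e)" using e by (simp add: d algebra_simps)
        then have "A1 = d * q ^ k * e" unfolding mult_left_cancel[OF nz(1)] .
        then have "q ^ k dvd A1" by simp
        then show False using q(3) by blast
      qed
      ultimately show ?thesis using q(1) by (intro exI[of _ q] exI[of _ "Suc k"]) simp
    qed
  qed
qed

lemma monic_dvd_linear_power:
  fixes P :: "'a::field poly"
  assumes "P dvd [:- l, 1:] ^ N" "lead_coeff P = 1"
  shows "\<exists>m\<le>N. P = [:- l, 1:] ^ m"
  using assms
proof (induction N arbitrary: P)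
  case 0
  then have "P = 1" by (intro monic_dvd_antisym) auto
  then show ?case by simp
next
  case (Suc N)
  show ?case
  proof (cases "poly P l = 0")
    case True
    then obtain R where R: "P = [:- l, 1:] * R" by (auto simp: poly_eq_0_iff_dvd)
    have "R dvd [:- l, 1:] ^ N"
      using Suc.prems(1) unfolding R power_Suc by (subst (asm) dvd_times_left_cancel_iff) auto
    moreover have "lead_coeff R = 1" using Suc.prems(2) unfolding R lead_coeff_mult by simp
    ultimately obtain m where "m \<le> N" "R = [:- l, 1:] ^ m" using Suc.IH by blast
    then show ?thesis using R by (intro exI[of _ "Suc m"]) simp
  next
    case False
    then have "comaximal P [:- l, 1:]" using comaximal_linear_if_no_root comaximal_sym by blast
    then have "P dvd [:- l, 1:] ^ N" using Suc.prems(1) unfolding power_Suc by (rule comaximal_dvd_mult)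
    then show ?thesis using Suc.IH Suc.prems(2) le_Suc_eq by blast
  qed
qed

abbreviation X2 :: "'a::comm_semiring_1 poly" where "X2 \<equiv> monom 1 2"

lemma poly_even_odd_split:
  fixes p :: "'a::field poly"
  shows "\<exists>a b. p = pcompose a X2 + [:0, 1:] * pcompose b X2"
proof (induction p)
  case 0 show ?case by (intro exI[of _ 0]) simp
next
  case (pCons c p)
  then obtain a b where ab: "p = pcompose a X2 + [:0, 1:] * pcompose b X2" by blast
  have "pCons c p = [:c:] + [:0, 1:] * p" by simp
  also have "\<dots> = pcompose (pCons c b) X2 + [:0, 1:] * pcompose a X2"
    by (subst ab) (simp add: pcompose_pCons algebra_simps monom_altdef power2_eq_square)
  finally show ?case by blast
qed

text \<open>
Linear factors are cancelled one by one: a root of the left product is not a root of \<open>Q'\<close>, so it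
occurs in the other list as well. This makes the rootless part well defined.
\<close>

lemma rootless_factorization_unique:
  fixes Q Q' :: "'a::field poly"
  assumes "(\<Prod>l\<leftarrow>ls. [:- l, 1:]) * Q = (\<Prod>l\<leftarrow>ms. [:- l, 1:]) * Q'"
    and "set ls \<subseteq> L" "set ms \<subseteq> L" "\<forall>l\<in>L. poly Q l \<noteq> 0" "\<forall>l\<in>L. poly Q' l \<noteq> 0"
  shows "Q = Q'"
  using assms
proof (induction ls arbitrary: ms)
  case Nil
  show ?case
  proof (cases ms)
    case (Cons m ms')
    then have "poly Q m = 0" using Nil.prems(1) by simp
    then show ?thesis using Nil.prems Cons by auto
  qed (use Nil.prems in simp)
next
  case (Cons l ls)
  have "poly ((\<Prod>l\<leftarrow>ms. [:- l, 1:]) * Q') l = 0"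
    unfolding Cons.prems(1)[symmetric] by simp
  then have "poly (\<Prod>l\<leftarrow>ms. [:- l, 1:]) l = 0" using Cons.prems by auto
  then have "l \<in> set ms" by (induction ms) auto
  then obtain m1 m2 where ms: "ms = m1 @ l # m2" by (meson split_list)
  have "[:- l, 1:] * ((\<Prod>l\<leftarrow>ls. [:- l, 1:]) * Q) = [:- l, 1:] * ((\<Prod>l\<leftarrow>m1 @ m2. [:- l, 1:]) * Q')"
    using Cons.prems(1) unfolding ms by (simp only: list.map map_append prod_list.append prod_list.Cons mult_ac)
  then have "(\<Prod>l\<leftarrow>ls. [:- l, 1:]) * Q = (\<Prod>l\<leftarrow>m1 @ m2. [:- l, 1:]) * Q'"
    by (subst (asm) mult_left_cancel) simp_all
  then show ?case using Cons.prems by (intro Cons.IH[of "m1 @ m2"]) (auto simp: ms)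
qed

lemma rootless_factorization_exists:
  fixes P :: "'a::field poly"
  assumes "lead_coeff P = 1"
  shows "\<exists>ls Q. set ls \<subseteq> L \<and> P = (\<Prod>l\<leftarrow>ls. [:- l, 1:]) * Q \<and> lead_coeff Q = 1 \<and> (\<forall>l\<in>L. poly Q l \<noteq> 0)"
  using assms
proof (induction "degree P" arbitrary: P rule: less_induct)
  case less
  show ?case
  proof (cases "\<forall>l\<in>L. poly P l \<noteq> 0")
    case True
    then show ?thesis using less.prems by (intro exI[of _ "[]"] exI[of _ P]) simp
  next
    case False
    then obtain l where l: "l \<in> L" "poly P l = 0" by blast
    then obtain R where R: "P = [:- l, 1:] * R" by (auto simp: poly_eq_0_iff_dvd)
    have lc: "lead_coeff R = 1" using less.prems unfolding R lead_coeff_mult by simp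
    then have "R \<noteq> 0" by auto
    then have "degree R < degree P" unfolding R by (subst degree_mult_eq) auto
    then obtain ls Q where "set ls \<subseteq> L" "R = (\<Prod>l\<leftarrow>ls. [:- l, 1:]) * Q" "lead_coeff Q = 1" "\<forall>l\<in>L. poly Q l \<noteq> 0"
      using less.hyps lc by blast
    then show ?thesis using l R by (intro exI[of _ "l # ls"] exI[of _ Q]) (simp add: mult_ac)
  qed
qed

lemma rootless_partE:
  fixes P :: "'a::field poly"
  assumes "lead_coeff P = 1"
  obtains ls where "set ls \<subseteq> L" "P = (\<Prod>l\<leftarrow>ls. [:- l, 1:]) * rootless_part L P"
    "\<forall>l\<in>L. poly (rootless_part L P) l \<noteq> 0"
proof -
  let ?C = "\<lambda>Q. lead_coeff Q = 1 \<and> (\<forall>l\<in>L. poly Q l \<noteq> 0) \<and>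
       (\<exists>ls. set ls \<subseteq> L \<and> P = (\<Prod>l\<leftarrow>ls. [:- l, 1:]) * Q)"
  have "\<exists>!Q. ?C Q"
  proof (rule ex_ex1I)
    show "\<exists>Q. ?C Q" using rootless_factorization_exists[OF assms, of L] by metis
    fix Q Q' assume Q: "?C Q" and Q': "?C Q'"
    obtain ls where ls: "set ls \<subseteq> L" "P = (\<Prod>l\<leftarrow>ls. [:- l, 1:]) * Q" using Q by blast
    obtain ms where ms: "set ms \<subseteq> L" "P = (\<Prod>l\<leftarrow>ms. [:- l, 1:]) * Q'" using Q' by blast
    show "Q = Q'"
      by (rule rootless_factorization_unique[of ls Q ms Q' L]) (use ls ms Q Q' in auto)
  qed
  then have "?C (rootless_part L P)" unfolding rootless_part_def by (rule theI')
  then show ?thesis using that by blast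
qed

text \<open>
The polynomial \<open>p(-X)\<close>: moving \<open>p(u)\<close> past a map that anticommutes with \<open>u\<close> turns it into \<open>p(-u)\<close>.
\<close>

abbreviation reflect :: "'a::comm_ring_1 poly \<Rightarrow> 'a poly" where
  "reflect p \<equiv> pcompose p [:0, - 1:]"

lemma reflect_reflect: "reflect (reflect p) = p"
  by (simp add: pcompose_assoc[symmetric] pcompose_pCons)

lemma reflect_linear: "reflect [:- l, 1:] = - [:l, 1:]"
  by (simp add: pcompose_pCons)

lemma reflect_linear_power: "reflect ([:- l, 1:] ^ m) = (- [:l, 1:]) ^ m"
proof (induction m)
  case (Suc m)
  then show ?case by (simp only: power_Suc pcompose_mult reflect_linear)
qed (simp add: pcompose_1)

lemma reflect_linear_power_dvd:
  assumes "[:- l, 1:] ^ m dvd p" shows "[:l, 1:] ^ m dvd reflect p"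
proof -
  obtain r where "p = [:- l, 1:] ^ m * r" using assms by blast
  then have "reflect p = (- [:l, 1:]) ^ m * reflect r" by (simp only: pcompose_mult reflect_linear_power)
  then show ?thesis by (simp only: power_minus[of "[:l, 1:]"] mult.assoc) (simp add: dvd_mult)
qed

lemma reflect_power_odd:
  assumes "reflect T = - T" shows "T ^ N dvd reflect (T ^ N :: 'a::comm_ring_1 poly)"
proof -
  have "reflect (T ^ N) = (- T) ^ N"
    by (induction N) (simp_all add: pcompose_mult assms pcompose_1)
  moreover have "T ^ N dvd (- T) ^ N" by (rule dvd_power_same) simp
  ultimately show ?thesis by simp
qed

lemma pcompose_dvd: "p dvd q \<Longrightarrow> pcompose p r dvd pcompose q (r :: 'a::comm_ring_1 poly)"
  by (auto simp: dvd_def pcompose_mult)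

lemma coeff_pcompose_X2_odd: "odd i \<Longrightarrow> coeff (pcompose S X2) i = (0 :: 'a::field)"
proof (induction S arbitrary: i)
  case (pCons c S)
  have "coeff [:c:] i = 0" using pCons.prems by (cases i) auto
  moreover have "coeff (X2 * pcompose S X2) i = 0"
    using pCons.IH[of "i - 2"] pCons.prems by (auto simp: coeff_monom_mult)
  ultimately show ?case by (simp add: pcompose_pCons)
qed simp

lemma even_poly_parity:
  fixes P :: "'a::field poly"
  assumes "even_poly P" "i \<le> degree P" "coeff P i \<noteq> 0" shows "even (degree P - i)"
proof -
  obtain S where S: "P = pcompose S X2" using assms(1) unfolding even_poly_def polynomial_of_def by blast
  then have "even (degree P)" by (simp add: degree_pcompose degree_monom_eq)
  moreover have "even i" using coeff_pcompose_X2_odd assms(3) S by blast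
  ultimately show ?thesis by simp
qed

lemma prod_list_linear_dvd_power:
  assumes "set ls \<subseteq> L" "\<And>l. l \<in> L \<Longrightarrow> [:- l, 1:] dvd T"
  shows "(\<Prod>l\<leftarrow>ls. [:- l, 1:]) dvd (T :: 'a::field poly) ^ length ls"
  using assms(1)
proof (induction ls)
  case (Cons l ls)
  have "[:- l, 1:] * (\<Prod>l\<leftarrow>ls. [:- l, 1:]) dvd T * T ^ length ls"
    using Cons assms(2) by (intro mult_dvd_mono) auto
  then show ?case by simp
qed simp

section \<open>Block matrices with a grading\<close>

lemma sum_lessThan_add:
  fixes f :: "nat \<Rightarrow> 'a::comm_monoid_add"
  shows "(\<Sum>i<n + m. f i) = (\<Sum>i<n. f i) + (\<Sum>i<m. f (n + i))"
  by (induction m) (simp_all add: add.assoc)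

text \<open>
If the degrees occurring in a polynomial all have the parity of its leading degree, its companion matrix
only connects positions of opposite parity. Hence \<open>\<epsilon>\<close> is the parity of a position relative to the
start of its own block.
\<close>

lemma diag_block_companion_parity:
  fixes Ps :: "'a::field poly list"
  assumes "\<And>P i. P \<in> set Ps \<Longrightarrow> i < degree P \<Longrightarrow> coeff P i \<noteq> 0 \<Longrightarrow> even (degree P - i)"
  shows "\<exists>\<epsilon>. \<forall>i<sum_list (map degree Ps). \<forall>j<sum_list (map degree Ps).
    diag_block_mat (map companion_mat Ps) $$ (i, j) \<noteq> 0 \<longrightarrow> \<epsilon> i \<noteq> (\<epsilon> j :: bool)"
  using assms
proof (induction Ps)
  case (Cons P Ps)
  let ?d = "degree P" and ?n = "sum_list (map degree Ps)"
  let ?D = "diag_block_mat (map companion_mat Ps)"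
  have "\<exists>\<epsilon>. \<forall>i<?n. \<forall>j<?n. ?D $$ (i, j) \<noteq> 0 \<longrightarrow> \<epsilon> i \<noteq> (\<epsilon> j :: bool)"
    by (rule Cons.IH, rule Cons.prems) simp_all
  then obtain \<epsilon> :: "nat \<Rightarrow> bool" where \<epsilon>: "\<And>i j. i < ?n \<Longrightarrow> j < ?n \<Longrightarrow> ?D $$ (i, j) \<noteq> 0 \<Longrightarrow> \<epsilon> i \<noteq> \<epsilon> j"
    by blast
  define \<delta> where "\<delta> i = (if i < ?d then even i else \<epsilon> (i - ?d))" for i
  have dims: "dim_row ?D = ?n" "dim_col ?D = ?n"
    by (auto simp: dim_diag_block_mat companion_mat_def Let_def o_def)
  have dimP: "dim_row (companion_mat P) = ?d" "dim_col (companion_mat P) = ?d"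
    by (auto simp: companion_mat_def Let_def)
  have P: "even i \<noteq> even j" if "i < ?d" "j < ?d" "companion_mat P $$ (i, j) \<noteq> 0" for i j
  proof (cases "j = ?d - 1")
    case True
    then have "coeff P i \<noteq> 0" using that by (simp add: companion_mat_def Let_def)
    then have "even (?d - i)" using Cons.prems that(1) by simp
    then show ?thesis using True that(1) by (auto simp: even_diff_nat)
  next
    case False
    then have "i = j + 1" using that by (simp add: companion_mat_def Let_def split: if_splits)
    then show ?thesis by simp
  qed
  have "\<delta> i \<noteq> \<delta> j" if ij: "i < ?d + ?n" "j < ?d + ?n"
    "diag_block_mat (map companion_mat (P # Ps)) $$ (i, j) \<noteq> 0" for i j
  proof -
    have "diag_block_mat (map companion_mat (P # Ps)) $$ (i, j) =
      (if i < ?d then if j < ?d then companion_mat P $$ (i, j) else 0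
       else if j < ?d then 0 else ?D $$ (i - ?d, j - ?d))"
      using ij(1,2) by (simp add: Let_def dims dimP)
    then show ?thesis using ij P[of i j] \<epsilon>[of "i - ?d" "j - ?d"]
      unfolding \<delta>_def by (auto split: if_splits)
  qed
  then show ?case by (intro exI[of _ \<delta>]) simp
qed simp

section \<open>Direct sums of subspaces\<close>

context finite_dimensional_vector_space
begin

definition direct_sum :: "'b set \<Rightarrow> 'b set \<Rightarrow> 'b set \<Rightarrow> bool" where
  "direct_sum W A B \<longleftrightarrow> subspace A \<and> subspace B \<and> A \<inter> B = {0} \<and> W = {x + y | x y. x \<in> A \<and> y \<in> B}"

lemma direct_sum_subspace: "direct_sum W A B \<Longrightarrow> subspace W"
  unfolding direct_sum_def by (auto intro: subspace_sums)

lemma direct_sum_sym: "direct_sum W A B \<Longrightarrow> direct_sum W B A"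
proof -
  assume "direct_sum W A B"
  moreover have "{x + y | x y. x \<in> A \<and> y \<in> B} = {x + y | x y. x \<in> B \<and> y \<in> A}"
    by (auto; use add.commute in blast)
  ultimately show "direct_sum W B A" unfolding direct_sum_def by (simp add: Int_commute)
qed

lemma direct_sum_subset:
  assumes "direct_sum W A B" shows "A \<subseteq> W" "B \<subseteq> W"
proof -
  have "0 \<in> A" "0 \<in> B" and W: "W = {x + y | x y. x \<in> A \<and> y \<in> B}"
    using assms subspace_0 unfolding direct_sum_def by auto
  have "x \<in> W" if "x \<in> A" for x
    unfolding W using that \<open>0 \<in> B\<close> by (intro CollectI exI[of _ x] exI[of _ 0]) simp
  then show "A \<subseteq> W" by blast
  have "x \<in> W" if "x \<in> B" for x
    unfolding W using that \<open>0 \<in> A\<close> by (intro CollectI exI[of _ 0] exI[of _ x]) simp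
  then show "B \<subseteq> W" by blast
qed

lemma direct_sumE:
  assumes "direct_sum W A B" "x \<in> W"
  obtains a b where "a \<in> A" "b \<in> B" "x = a + b"
  using assms unfolding direct_sum_def by blast

lemma direct_sum_eq_0:
  assumes "direct_sum W A B" "a \<in> A" "b \<in> B" "a + b = 0"
  shows "a = 0 \<and> b = 0"
proof -
  have A: "subspace A" and B: "subspace B" and AB: "A \<inter> B = {0}"
    using assms(1) unfolding direct_sum_def by auto
  have "a = - b" using assms(4) by (simp add: eq_neg_iff_add_eq_0)
  then have "a \<in> A \<inter> B" using assms(2,3) subspace_neg[OF B] by simp
  then show ?thesis using AB assms(4) by auto
qed

lemma direct_sum_dim:
  assumes "direct_sum W A B" shows "dim W = dim A + dim B"
proof -
  have "dim {x + y | x y. x \<in> A \<and> y \<in> B} + dim (A \<inter> B) = dim A + dim B"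
    using assms unfolding direct_sum_def by (intro dim_sums_Int) auto
  then show ?thesis using assms unfolding direct_sum_def by simp
qed

lemma direct_sum_bases:
  assumes "direct_sum W A B" "independent S" "span S = A" "independent T" "span T = B"
  shows "S \<inter> T = {}" "independent (S \<union> T)" "span (S \<union> T) = W"
proof -
  have AB: "A \<inter> B = {0}" "W = {x + y | x y. x \<in> A \<and> y \<in> B}"
    using assms unfolding direct_sum_def by auto
  have "S \<inter> T \<subseteq> {0}" using AB(1) assms(3,5) span_superset[of S] span_superset[of T] by blast
  moreover have "0 \<notin> S" using assms(2) dependent_zero by blast
  ultimately show disj: "S \<inter> T = {}" by blast
  show sp: "span (S \<union> T) = W" unfolding span_Un assms AB(2) by blast
  have fin: "finite S" "finite T" using assms finiteI_independent by auto
  have "card (S \<union> T) = dim W"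
    using card_Un_disjoint[OF fin disj] direct_sum_dim[OF assms(1)] assms(3,5)
      dim_span_eq_card_independent[OF assms(2)] dim_span_eq_card_independent[OF assms(4)] by simp
  then show "independent (S \<union> T)"
    using fin sp span_superset[of "S \<union> T"] by (intro card_le_dim_spanning[where V = W]) auto
qed

lemma direct_sum_linear_extension:
  assumes "direct_sum W A B" "Vector_Spaces.linear scale scale a" "Vector_Spaces.linear scale scale b"
  shows "\<exists>f. Vector_Spaces.linear scale scale f \<and> (\<forall>x\<in>A. f x = a x) \<and> (\<forall>x\<in>B. f x = b x)"
proof -
  interpret vector_space_pair scale scale by unfold_locales
  have sub: "subspace A" "subspace B" using assms(1) unfolding direct_sum_def by auto
  obtain S where S: "independent S" "span S = A"
    by (rule basis_subspace_exists[OF sub(1)])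
  obtain T where T: "independent T" "span T = B"
    by (rule basis_subspace_exists[OF sub(2)])
  note ST = direct_sum_bases[OF assms(1) S T]
  obtain f where f: "Vector_Spaces.linear scale scale f"
    "\<forall>x\<in>S \<union> T. f x = (if x \<in> S then a x else b x)"
    using linear_independent_extend[OF ST(2), of "\<lambda>x. if x \<in> S then a x else b x"] by blast
  have "f x = a x" if "x \<in> A" for x
    using f that S by (intro linear_eq_on[OF f(1) assms(2), of x S]) auto
  moreover have "f x = b x" if "x \<in> B" for x
    using f that T ST(1) by (intro linear_eq_on[OF f(1) assms(3), of x T]) auto
  ultimately show ?thesis using f(1) by blast
qed

lemma exists_complement:
  assumes "subspace A" "subspace B" "A \<subseteq> B"
  obtains T where "direct_sum B A T"
proof -
  obtain S where S: "S \<subseteq> A" "independent S" "span S = A"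
    by (rule basis_subspace_exists[OF assms(1)])
  obtain R where R: "S \<subseteq> R" "R \<subseteq> B" "independent R" "B \<subseteq> span R"
    using maximal_independent_subset_extend[of S B] S assms by blast
  have spR: "span R = B" using R assms(2) span_minimal by blast
  let ?T = "span (R - S)"
  have sum: "B = {x + y | x y. x \<in> A \<and> y \<in> ?T}"
    unfolding spR[symmetric] S(3)[symmetric] span_Un[symmetric] using R(1) by (simp add: Un_absorb1)
  have fin: "finite R" using R finiteI_independent by blast
  have iT: "independent (R - S)" using R(3) independent_mono by blast
  have "dim B + dim (A \<inter> ?T) = dim A + dim ?T"
    using dim_sums_Int[OF assms(1) subspace_span[of "R - S"]] unfolding sum[symmetric] by simp
  moreover have "dim B = card R" "dim A = card S" "dim ?T = card (R - S)"
    using dim_span_eq_card_independent[OF R(3)] dim_span_eq_card_independent[OF S(2)]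
      dim_span_eq_card_independent[OF iT] spR S(3) by simp_all
  moreover have "card R = card S + card (R - S)"
    using card_Un_disjoint[of S "R - S"] fin R(1) by (simp add: finite_subset Un_absorb1)
  ultimately have "dim (A \<inter> ?T) = 0" by simp
  moreover have "0 \<in> A \<inter> ?T" using subspace_0[OF assms(1)] span_zero by simp
  ultimately have "A \<inter> ?T = {0}" by auto
  then have "direct_sum B A ?T" unfolding direct_sum_def using assms(1) sum by simp
  then show ?thesis using that by blast
qed

text \<open>
The map \<open>f\<close> induces an injection of \<open>B / A\<close> into \<open>D / C\<close>. Complements replace the quotients.
\<close>

lemma dim_quotient_le:
  assumes f: "Vector_Spaces.linear scale scale f"
    and sub: "subspace A" "subspace B" "subspace C" "subspace D"
    and A: "A = {x \<in> B. f x \<in> C}" and D: "f ` B \<subseteq> D" "C \<subseteq> D"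
  shows "dim B + dim C \<le> dim A + dim D"
proof -
  interpret f: Vector_Spaces.linear scale scale f by (rule f)
  interpret p: finite_dimensional_vector_space_pair scale Basis scale Basis by unfold_locales
  obtain T where T: "direct_sum B A T" using exists_complement[OF sub(1,2)] A by blast
  then have sT: "subspace T" "A \<inter> T = {0}" "T \<subseteq> B"
    using direct_sum_subset[OF T] unfolding direct_sum_def by auto
  have TC: "x = 0" if "x \<in> T" "f x \<in> C" for x
    using that sT A by auto
  have "inj_on f T"
  proof (rule inj_onI)
    fix x y assume "x \<in> T" "y \<in> T" "f x = f y"
    then have "x - y = 0"
      using subspace_0[OF sub(3)] by (intro TC) (simp_all add: subspace_diff[OF sT(1)] f.diff)
    then show "x = y" by simp
  qed
  then have dT: "dim (f ` T) = dim T"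
    using p.dim_image_eq[OF f, of T] span_eq_iff[THEN iffD2, OF sT(1)] \<open>inj_on f T\<close> by simp
  have sfT: "subspace (f ` T)" using f.subspace_image sT(1) by blast
  have int: "f ` T \<inter> C = {0}"
  proof (intro equalityI subsetI)
    fix z assume "z \<in> f ` T \<inter> C"
    then obtain x where "x \<in> T" "z = f x" "f x \<in> C" by blast
    moreover from this have "x = 0" using TC by blast
    ultimately show "z \<in> {0}" by (simp add: f.zero)
  qed (use subspace_0[OF sub(3)] subspace_0[OF sfT] in simp)
  have "{x + y | x y. x \<in> f ` T \<and> y \<in> C} \<subseteq> D"
    using D sT(3) sub(4) by (auto intro!: subspace_add)
  then have "dim {x + y | x y. x \<in> f ` T \<and> y \<in> C} \<le> dim D" by (rule dim_subset)
  then have "dim (f ` T) + dim C \<le> dim D"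
    using dim_sums_Int[OF sfT sub(3)] int by simp
  then show ?thesis using direct_sum_dim[OF T] dT by linarith
qed

end

section \<open>Polynomials in an operator\<close>

lemma vector_space_smult: "vector_space (Polynomial.smult :: 'a::field \<Rightarrow> 'a poly \<Rightarrow> 'a poly)"
  by unfold_locales (simp_all add: smult_add_right smult_add_left)

text \<open>
The endomorphism is a locale parameter because the theory is needed both for \<open>u\<close> and for \<open>u\<^sup>2\<close>.
\<close>

locale operator = finite_dimensional_vector_space scale Basis
  for scale :: "'k::field \<Rightarrow> 'e::ab_group_add \<Rightarrow> 'e" (infixr "*s" 75) and Basis :: "'e set" +
  fixes u :: "'e \<Rightarrow> 'e"
  assumes linear_u: "Vector_Spaces.linear scale scale u"
begin

sublocale u: Vector_Spaces.linear scale scale u by (rule linear_u)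

abbreviation ev :: "'k poly \<Rightarrow> 'e \<Rightarrow> 'e" where
  "ev P \<equiv> poly_endo scale P u"

lemma ev_eq_sum:
  assumes "degree P \<le> N" shows "ev P x = (\<Sum>i\<le>N. coeff P i *s (u ^^ i) x)"
  unfolding poly_endo_def
  by (rule sum.mono_neutral_left) (use assms in \<open>auto simp: coeff_eq_0\<close>)

lemma ev_0 [simp]: "ev 0 x = 0"
  by (simp add: poly_endo_def)

lemma ev_pCons [simp]: "ev (pCons c P) x = c *s x + u (ev P x)"
proof -
  have "ev (pCons c P) x = (\<Sum>i\<le>Suc (degree P). coeff (pCons c P) i *s (u ^^ i) x)"
    by (rule ev_eq_sum) (rule degree_pCons_le)
  also have "\<dots> = c *s x + (\<Sum>i\<le>degree P. coeff P i *s (u ^^ Suc i) x)"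
    by (subst sum.atMost_Suc_shift) simp
  also have "(\<Sum>i\<le>degree P. coeff P i *s (u ^^ Suc i) x) = u (ev P x)"
    by (simp add: poly_endo_def u.sum u.scale)
  finally show ?thesis .
qed

lemma ev_add [simp]: "ev (P + Q) x = ev P x + ev Q x"
proof -
  let ?N = "max (degree P) (degree Q)"
  have "degree (P + Q) \<le> ?N" by (rule degree_add_le_max)
  then show ?thesis
    by (simp add: ev_eq_sum[of _ ?N] scale_left_distrib sum.distrib)
qed

lemma ev_smult [simp]: "ev (Polynomial.smult c P) x = c *s ev P x"
  by (simp add: ev_eq_sum[of "Polynomial.smult c P" "degree P"] poly_endo_def scale_sum_right)

lemma ev_minus [simp]: "ev (- P) x = - ev P x"
  using ev_smult[of "-1" P x] by simp

lemma ev_diff [simp]: "ev (P - Q) x = ev P x - ev Q x"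
  using ev_add[of P "- Q" x] by simp

lemma linear_ev: "Vector_Spaces.linear scale scale (ev P)"
proof (induction P)
  case 0
  show ?case by (simp add: Vector_Spaces.linear_iff vector_space_axioms)
next
  case (pCons c P)
  then interpret P: Vector_Spaces.linear scale scale "ev P" by simp
  show ?case
    by (simp add: Vector_Spaces.linear_iff vector_space_axioms P.add P.scale u.add u.scale
        scale_right_distrib mult.commute)
qed

lemma ev_vec_add: "ev P (x + y) = ev P x + ev P y"
  and ev_vec_scale: "ev P (c *s x) = c *s ev P x"
  and ev_vec_zero [simp]: "ev P 0 = 0"
  and ev_vec_neg: "ev P (- x) = - ev P x"
  and ev_vec_diff: "ev P (x - y) = ev P x - ev P y"
proof -
  interpret P: Vector_Spaces.linear scale scale "ev P" by (rule linear_ev)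
  show "ev P (x + y) = ev P x + ev P y" "ev P (c *s x) = c *s ev P x"
    "ev P 0 = 0" "ev P (- x) = - ev P x" "ev P (x - y) = ev P x - ev P y"
    by (simp_all add: P.add P.scale P.neg P.diff)
qed

lemma ev_u: "ev P (u x) = u (ev P x)"
  by (induction P) (simp_all add: u.add u.scale)

lemma ev_mult: "ev (P * Q) x = ev P (ev Q x)"
  by (induction P) simp_all

lemma ev_1 [simp]: "ev 1 x = x"
  by (simp add: one_pCons)

lemma ev_commute: "ev P (ev Q x) = ev Q (ev P x)"
  by (simp add: ev_mult[symmetric] mult.commute)

lemma ev_monom: "ev (monom c i) x = c *s (u ^^ i) x"
  by (simp add: ev_eq_sum[of _ i] degree_monom_le if_distrib[of "\<lambda>c. c *s _"] cong: if_cong)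

lemma ev_sum: "finite I \<Longrightarrow> ev (\<Sum>i\<in>I. P i) x = (\<Sum>i\<in>I. ev (P i) x)"
  by (induction I rule: finite_induct) simp_all

lemma ev_dvd_eq_0:
  assumes "P dvd Q" "ev P x = 0" shows "ev Q x = 0"
proof -
  obtain R where "Q = R * P" using assms(1) by (auto simp: dvd_def mult.commute)
  then show ?thesis using assms(2) by (simp add: ev_mult)
qed

definition invariant :: "'e set \<Rightarrow> bool" where
  "invariant W \<longleftrightarrow> subspace W \<and> (\<forall>x\<in>W. u x \<in> W)"

lemma invariant_ev: "invariant W \<Longrightarrow> x \<in> W \<Longrightarrow> ev P x \<in> W"
  unfolding invariant_def
  by (induction P) (auto simp: subspace_0 intro!: subspace_add subspace_scale)

lemma invariant_kernel_ev: "invariant {x. ev P x = 0}"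
  unfolding invariant_def subspace_def by (auto simp: ev_vec_add ev_vec_scale ev_u)

lemma invariant_sum:
  assumes "invariant A" "invariant B" shows "invariant {x + y | x y. x \<in> A \<and> y \<in> B}"
  using assms unfolding invariant_def by (auto intro!: subspace_sums simp: u.add) blast

lemma independent_orbit:
  assumes "\<And>p. degree p < m \<Longrightarrow> ev p e = 0 \<Longrightarrow> p = 0"
  shows "inj_on (\<lambda>i. (u ^^ i) e) {..<m}" "independent ((\<lambda>i. (u ^^ i) e) ` {..<m})"
proof -
  let ?f = "\<lambda>i. (u ^^ i) e"
  have deg: "degree (monom c i :: 'k poly) < m" if "i < m" for i c
    using that degree_monom_le le_less_trans by blast
  show inj: "inj_on ?f {..<m}"
  proof (rule inj_onI)
    fix i j assume ij: "i \<in> {..<m}" "j \<in> {..<m}" "?f i = ?f j"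
    have "monom 1 i - monom 1 j = (0 :: 'k poly)"
      using ij by (intro assms degree_diff_less deg) (simp_all add: ev_monom)
    then have "coeff (monom 1 i) i = coeff (monom (1::'k) j) i" by simp
    then show "i = j" by (simp split: if_splits)
  qed
  have "\<forall>v\<in>?f ` {..<m}. c v = 0" if "(\<Sum>v\<in>?f ` {..<m}. c v *s v) = 0" for c
  proof -
    let ?p = "\<Sum>i<m. monom (c (?f i)) i"
    have "ev ?p e = (\<Sum>v\<in>?f ` {..<m}. c v *s v)"
      by (simp add: ev_sum ev_monom sum.reindex[OF inj])
    moreover have "degree ?p < m" if "i < m" for i
      using that by (intro degree_sum_less deg) auto
    ultimately have p0: "?p = 0" if "i < m" for i using assms[of ?p] \<open>_ = 0\<close> that by auto
    have "coeff ?p i = c (?f i)" if "i < m" for i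
      using that by (simp add: coeff_sum sum.delta)
    then show ?thesis using p0 by fastforce
  qed
  then show "independent (?f ` {..<m})" unfolding independent_explicit by blast
qed

lemma ev_power_Suc: "ev (P ^ Suc k) x = ev (P ^ k) (ev P x)"
  by (simp only: power_Suc2 ev_mult)

lemma ev_comaximal_eq_0:
  assumes "comaximal P Q" "ev P x = 0" "ev Q x = 0" shows "x = 0"
proof -
  obtain r s where rs: "r * P + s * Q = 1" using assms(1) unfolding comaximal_def by blast
  have "x = ev (r * P + s * Q) x" by (simp add: rs)
  also have "\<dots> = 0" by (simp only: ev_add ev_mult assms(2,3) ev_vec_zero add_0_left)
  finally show ?thesis .
qed

lemma comaximal_inverse:
  assumes "comaximal P Q"
  obtains r where "\<And>x. ev Q x = 0 \<Longrightarrow> ev P (ev r x) = x"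
proof -
  obtain r s where rs: "r * P + s * Q = 1" using assms unfolding comaximal_def by blast
  have "ev P (ev r x) = x" if "ev Q x = 0" for x
  proof -
    have "x = ev (r * P + s * Q) x" by (simp add: rs)
    also have "\<dots> = ev r (ev P x)" by (simp only: ev_add ev_mult that ev_vec_zero add_0_right)
    also have "\<dots> = ev P (ev r x)" by (rule ev_commute)
    finally show ?thesis by simp
  qed
  then show ?thesis using that by blast
qed

lemma direct_sum_kernels:
  assumes "comaximal P Q"
  shows "direct_sum {x. ev (P * Q) x = 0} {x. ev P x = 0} {x. ev Q x = 0}"
proof -
  have sub: "subspace {x. ev P x = 0}" "subspace {x. ev Q x = 0}"
    using invariant_kernel_ev unfolding invariant_def by blast+
  have "{x. ev P x = 0} \<inter> {x. ev Q x = 0} = {0}"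
    using ev_comaximal_eq_0[OF assms] by auto
  moreover have "{x. ev (P * Q) x = 0} = {x + y | x y. x \<in> {x. ev P x = 0} \<and> y \<in> {x. ev Q x = 0}}"
  proof (intro equalityI subsetI)
    fix x assume x: "x \<in> {x. ev (P * Q) x = 0}"
    obtain r s where rs: "r * P + s * Q = 1" using assms unfolding comaximal_def by blast
    have "ev (s * Q + r * P) x = x" using rs by (simp add: add.commute)
    then have "x = ev (s * Q) x + ev (r * P) x" by simp
    moreover have "ev P (ev (s * Q) x) = ev s (ev (P * Q) x)"
      unfolding ev_mult[symmetric] by (simp only: mult_ac)
    then have "ev P (ev (s * Q) x) = 0" using x by simp
    moreover have "ev Q (ev (r * P) x) = ev r (ev (P * Q) x)"
      unfolding ev_mult[symmetric] by (simp only: mult_ac)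
    then have "ev Q (ev (r * P) x) = 0" using x by simp
    ultimately show "x \<in> {x + y | x y. x \<in> {x. ev P x = 0} \<and> y \<in> {x. ev Q x = 0}}" by blast
  next
    fix z assume "z \<in> {x + y | x y. x \<in> {x. ev P x = 0} \<and> y \<in> {x. ev Q x = 0}}"
    then obtain x y where xy: "z = x + y" "ev P x = 0" "ev Q y = 0" by blast
    have "ev (P * Q) x = 0" using xy(2) by (simp add: mult.commute[of P] ev_mult)
    moreover have "ev (P * Q) y = 0" using xy(3) by (simp add: ev_mult)
    ultimately show "z \<in> {x. ev (P * Q) x = 0}" using xy(1) by (simp add: ev_vec_add)
  qed
  ultimately show ?thesis unfolding direct_sum_def using sub by blast
qed

section \<open>Annihilators and cyclic subspaces\<close>

text \<open>
\<open>P\<close> generates the ideal of polynomials that kill \<open>e\<close>. It is not normalized, so that products and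
cofactors of annihilators are again annihilators.
\<close>

definition annihilator :: "'e \<Rightarrow> 'k poly \<Rightarrow> bool" where
  "annihilator e P \<longleftrightarrow> (\<forall>p. ev p e = 0 \<longleftrightarrow> P dvd p)"

lemma annihilator_self: "annihilator e P \<Longrightarrow> ev P e = 0"
  unfolding annihilator_def by simp

text \<open>
Finite dimension bounds the number of independent vectors in the orbit of \<open>e\<close>, so the ideal is not zero.
\<close>

lemma exists_annihilator: "\<exists>P. annihilator e P \<and> lead_coeff P = 1"
proof -
  let ?I = "{p. ev p e = 0}"
  have "\<exists>p. ev p e = 0 \<and> p \<noteq> 0"
  proof (rule ccontr)
    assume "\<not> ?thesis"
    then have "\<And>p. ev p e = 0 \<Longrightarrow> p = 0" by blast
    note orb = independent_orbit[OF this, of "Suc dimension"]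
    have "card ((\<lambda>i. (u ^^ i) e) ` {..<Suc dimension}) = Suc dimension"
      using card_image[OF orb(1)] by simp
    moreover have "card ((\<lambda>i. (u ^^ i) e) ` {..<Suc dimension}) \<le> dim UNIV"
      using orb(2) by (intro independent_card_le_dim) auto
    ultimately show False by (simp add: dimension_def)
  qed
  then obtain p0 where "p0 \<in> ?I" "p0 \<noteq> 0" by blast
  then obtain g where "lead_coeff g = 1" "\<forall>f. f \<in> ?I \<longleftrightarrow> g dvd f"
    using poly_ideal_principal[of p0 ?I] by (auto simp: ev_mult)
  then show ?thesis unfolding annihilator_def by blast
qed

lemma exists_global_annihilating: "\<exists>M. M \<noteq> 0 \<and> (\<forall>x. ev M x = 0)"
proof -
  have "\<forall>b. \<exists>P. annihilator b P \<and> lead_coeff P = 1" using exists_annihilator by blast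
  then obtain P where P: "\<And>b. annihilator b (P b)" "\<And>b. lead_coeff (P b) = 1"
    unfolding choice_iff by blast
  let ?M = "\<Prod>b\<in>Basis. P b"
  have "P b \<noteq> 0" for b using P(2)[of b] by auto
  then have "?M \<noteq> 0" using finite_Basis by simp
  moreover have "ev ?M x = 0" for x
  proof -
    have "Basis \<subseteq> {x. ev ?M x = 0}"
      using P(1) finite_Basis unfolding annihilator_def by auto
    then have "span Basis \<subseteq> {x. ev ?M x = 0}"
      using span_minimal invariant_kernel_ev[of ?M] unfolding invariant_def by blast
    then show ?thesis using span_Basis by auto
  qed
  ultimately show ?thesis by blast
qed

lemma min_poly_props:
  shows "lead_coeff (min_poly scale u) = 1" "ev (min_poly scale u) x = 0"
    "(\<And>x. ev R x = 0) \<Longrightarrow> min_poly scale u dvd R"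
proof -
  let ?C = "\<lambda>P. lead_coeff P = 1 \<and> (\<forall>x. ev P x = 0) \<and> (\<forall>R. (\<forall>x. ev R x = 0) \<longrightarrow> P dvd R)"
  obtain M where M: "M \<noteq> 0" "\<forall>x. ev M x = 0" using exists_global_annihilating by blast
  then have "\<exists>g. g \<in> {p. \<forall>x. ev p x = 0} \<and> lead_coeff g = 1 \<and> (\<forall>f. f \<in> {p. \<forall>x. ev p x = 0} \<longleftrightarrow> g dvd f)"
    by (intro poly_ideal_principal[of M]) (simp_all add: ev_mult)
  then obtain g where "?C g" by auto
  moreover have "P = g" if "?C P" "?C g" for P g
    using that by (intro monic_dvd_antisym) auto
  ultimately have "\<exists>!P. ?C P" by blast
  then have "?C (min_poly scale u)" unfolding min_poly_def by (rule theI')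
  then show "lead_coeff (min_poly scale u) = 1" "ev (min_poly scale u) x = 0"
    "(\<And>x. ev R x = 0) \<Longrightarrow> min_poly scale u dvd R" by auto
qed

lemma annihilator_ev:
  assumes "annihilator x (C * D)" "C \<noteq> 0" shows "annihilator (ev C x) D"
  unfolding annihilator_def
proof
  fix p
  have "ev p (ev C x) = 0 \<longleftrightarrow> C * D dvd C * p"
    using assms(1) unfolding annihilator_def ev_mult[symmetric] by (simp add: mult.commute)
  also have "\<dots> \<longleftrightarrow> D dvd p" using assms(2) by (rule dvd_times_left_cancel_iff)
  finally show "ev p (ev C x) = 0 \<longleftrightarrow> D dvd p" .
qed

lemma annihilator_add:
  assumes x: "annihilator x A" and y: "annihilator y B" and AB: "comaximal A B"
  shows "annihilator (x + y) (A * B)"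
  unfolding annihilator_def
proof (intro allI iffI)
  fix p assume p: "ev p (x + y) = 0"
  have "ev (A * p) y = 0"
  proof -
    have "ev (A * p) x = 0" using x unfolding annihilator_def by simp
    moreover have "ev (A * p) (x + y) = 0" by (simp add: ev_mult p)
    ultimately show ?thesis by (simp add: ev_vec_add)
  qed
  then have "B dvd A * p" using y unfolding annihilator_def by blast
  then have "B dvd p" using AB comaximal_dvd_mult comaximal_sym by blast
  have "ev (B * p) x = 0"
  proof -
    have "ev (B * p) y = 0" using y unfolding annihilator_def by simp
    moreover have "ev (B * p) (x + y) = 0" by (simp add: ev_mult p)
    ultimately show ?thesis by (simp add: ev_vec_add)
  qed
  then have "A dvd B * p" using x unfolding annihilator_def by blast
  then have "A dvd p" using AB comaximal_dvd_mult by blast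
  then show "A * B dvd p" using \<open>B dvd p\<close> AB by (intro comaximal_mult_dvd)
next
  fix p assume "A * B dvd p"
  then have "A dvd p" "B dvd p" by (auto dest: dvd_mult_left dvd_mult_right)
  then have "ev p x = 0" "ev p y = 0" using x y unfolding annihilator_def by blast+
  then show "ev p (x + y) = 0" by (simp add: ev_vec_add)
qed

text \<open>
A vector \<open>e\<close> of \<open>W\<close> whose annihilator \<open>P\<close> has the largest degree does it. If \<open>P(u)\<close> did not kill some
\<open>y\<close>, then a prime power \<open>p\<^sup>k\<close> would divide the annihilator of \<open>y\<close> but not \<open>P\<close>. Exchanging the
\<open>p\<close>-primary part of \<open>e\<close> for that of \<open>y\<close> would give a vector with an annihilator of larger degree.
\<close>

lemma exists_maximal_vector:
  assumes W: "invariant W"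
  obtains e P where "e \<in> W" "annihilator e P" "lead_coeff P = 1" "\<And>x. x \<in> W \<Longrightarrow> ev P x = 0"
proof -
  obtain M where M: "M \<noteq> 0" "\<forall>x. ev M x = 0" using exists_global_annihilating by blast
  let ?C = "\<lambda>(e, P). e \<in> W \<and> annihilator e P"
  obtain P0 where "annihilator 0 P0" using exists_annihilator by blast
  moreover have "0 \<in> W" using W subspace_0 unfolding invariant_def by blast
  ultimately have "?C (0, P0)" by simp
  moreover have "\<forall>z. ?C z \<longrightarrow> degree (snd z) < Suc (degree M)"
    using M unfolding annihilator_def by (auto simp: less_Suc_eq_le intro!: dvd_imp_degree_le)
  ultimately obtain z where z: "?C z" "\<forall>y. ?C y \<longrightarrow> degree (snd y) \<le> degree (snd z)"
    using ex_has_greatest_nat[of ?C "(0, P0)" "\<lambda>z. degree (snd z)"] by blast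
  define e where "e = fst z"
  have e: "e \<in> W" "annihilator e (snd z)" using z(1) by (auto simp: e_def split_beta)
  obtain P where P: "annihilator e P" "lead_coeff P = 1" using exists_annihilator by blast
  have max: "degree B \<le> degree P" if "y \<in> W" "annihilator y B" for y B
  proof -
    have "degree B \<le> degree (snd z)" using z(2) that by force
    moreover have "snd z dvd P" using e(2) P(1) annihilator_self unfolding annihilator_def by blast
    ultimately show ?thesis using P(2) dvd_imp_degree_le[of "snd z" P] by fastforce
  qed
  have "ev P y = 0" if y: "y \<in> W" for y
  proof (rule ccontr)
    assume ne: "ev P y \<noteq> 0"
    obtain B where B: "annihilator y B" "lead_coeff B = 1" using exists_annihilator by blast
    have nz: "P \<noteq> 0" "B \<noteq> 0" using P(2) B(2) by auto
    have "\<not> B dvd P" using B(1) ne unfolding annihilator_def by blast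
    then obtain p k where p: "prime_elem p" "p ^ k dvd B" "\<not> p ^ k dvd P"
      using not_dvd_prime_power[OF nz] by blast
    \<comment> \<open>The exact power of \<open>p\<close> in \<open>P\<close> is \<open>p ^ (j - 1)\<close>.\<close>
    define j where "j = (LEAST j. \<not> p ^ j dvd P)"
    have j: "\<not> p ^ j dvd P" "j \<le> k" unfolding j_def
      by (rule LeastI[of "\<lambda>j. \<not> p ^ j dvd P", OF p(3)]) (rule Least_le, rule p(3))
    then have "j \<noteq> 0" by (intro notI) simp
    then obtain a where a: "j = Suc a" using not0_implies_Suc by blast
    have "p ^ a dvd P" using not_less_Least[of a "\<lambda>j. \<not> p ^ j dvd P"] unfolding j_def[symmetric] a by simp
    then obtain A where A: "P = p ^ a * A" by blast
    have pA: "\<not> p dvd A"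
    proof
      assume "p dvd A"
      then have "p ^ a * p dvd p ^ a * A" by (rule mult_dvd_mono[OF dvd_refl])
      then have "p ^ j dvd P" by (simp only: A a power_Suc mult.commute[of p])
      then show False using j(1) by blast
    qed
    obtain B' where "B = p ^ k * B'" using p(2) by blast
    then have B': "B = B' * p ^ k" by (simp only: mult.commute)
    have "p ^ a * A \<noteq> 0" "B' * p ^ k \<noteq> 0" using nz unfolding A[symmetric] B'[symmetric] .
    moreover have "p \<noteq> 0" using p(1) unfolding prime_elem_def by blast
    ultimately have nz': "p \<noteq> 0" "A \<noteq> 0" "B' \<noteq> 0" "p ^ a \<noteq> 0" by simp_all
    have "comaximal A (p ^ k)"
      using comaximal_power[OF prime_comaximal[OF p(1) pA], of k 1] by (simp add: comaximal_sym)
    then have "annihilator (ev (p ^ a) e + ev B' y) (A * p ^ k)"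
      using annihilator_ev[OF P(1)[unfolded A] nz'(4)] annihilator_ev[OF B(1)[unfolded B'] nz'(3)]
      by (intro annihilator_add)
    moreover have "ev (p ^ a) e + ev B' y \<in> W"
      using W e(1) y invariant_ev[OF W] unfolding invariant_def by (auto intro: subspace_add)
    ultimately have "degree (A * p ^ k) \<le> degree P" using max by blast
    moreover have "degree p > 0"
      using p(1) is_unit_iff_degree[of p] by (auto simp: prime_elem_def)
    ultimately show False using nz' a j(2) unfolding A by (simp add: degree_mult_eq degree_power_eq)
  qed
  then show ?thesis using that e(1) P by blast
qed

text \<open>
A linear map on the cyclic subspace of \<open>e\<close> is a linear map on polynomials that kills the annihilator
ideal of \<open>e\<close>. The functional behind \<open>cyclic_complement\<close> and the maps in
\<open>anticommuting_root_cyclic_pair\<close> are obtained in this way.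
\<close>

lemma cyclic_linear_extension:
  fixes t :: "'k \<Rightarrow> 'c::ab_group_add \<Rightarrow> 'c"
  assumes \<phi>: "Vector_Spaces.linear Polynomial.smult t \<phi>" and ker: "\<And>p. ev p e = 0 \<Longrightarrow> \<phi> p = 0"
  shows "\<exists>f. Vector_Spaces.linear scale t f \<and> (\<forall>p. f (ev p e) = \<phi> p)"
proof -
  interpret \<phi>: Vector_Spaces.linear Polynomial.smult t \<phi> by (rule \<phi>)
  interpret ps: vector_space Polynomial.smult by (rule vector_space_smult)
  interpret p1: vector_space_pair Polynomial.smult scale
    by (intro vector_space_pair.intro vector_space_smult vector_space_axioms)
  have "Vector_Spaces.linear Polynomial.smult scale (\<lambda>p. ev p e)"
    by (simp add: Vector_Spaces.linear_iff vector_space_smult vector_space_axioms)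
  then obtain r where r: "Vector_Spaces.linear scale Polynomial.smult r" "\<forall>v\<in>range (\<lambda>p. ev p e). ev (r v) e = v"
    using p1.linear_exists_right_inverse_on[of "\<lambda>p. ev p e" UNIV] ps.subspace_UNIV by auto
  have "\<phi> (r (ev p e)) = \<phi> p" for p
  proof -
    have "ev (r (ev p e) - p) e = 0" using r(2) by simp
    then have "\<phi> (r (ev p e) - p) = 0" by (rule ker)
    then show ?thesis by (simp add: \<phi>.diff)
  qed
  moreover have "Vector_Spaces.linear scale t (\<phi> \<circ> r)"
    using r(1) \<phi> by (simp add: Vector_Spaces.linear_iff)
  ultimately show ?thesis by (intro exI[of _ "\<phi> \<circ> r"]) simp
qed

definition cyclic :: "'e \<Rightarrow> 'e set" where
  "cyclic e = range (\<lambda>p. ev p e)"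

lemma cyclicI [simp]: "ev p e \<in> cyclic e"
  unfolding cyclic_def by simp

lemma invariant_cyclic: "invariant (cyclic e)"
proof -
  have "u (ev p e) \<in> cyclic e" for p using cyclicI[of "pCons 0 p" e] by (simp del: cyclicI)
  moreover have "c *s ev p e \<in> cyclic e" for c p using cyclicI[of "Polynomial.smult c p" e] by (simp del: cyclicI)
  moreover have "ev p e + ev q e \<in> cyclic e" for p q using cyclicI[of "p + q" e] by (simp del: cyclicI)
  moreover have "0 \<in> cyclic e" using cyclicI[of 0 e] by (simp del: cyclicI)
  ultimately show ?thesis unfolding invariant_def subspace_def
    by (auto simp: cyclic_def[of e, THEN eq_reflection])
qed

lemma self_in_cyclic: "e \<in> cyclic e"
  using cyclicI[of 1 e] by simp

lemma cyclic_subset: "invariant W \<Longrightarrow> e \<in> W \<Longrightarrow> cyclic e \<subseteq> W"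
  unfolding cyclic_def using invariant_ev by blast

text \<open>
Let \<open>m\<close> be the degree of \<open>P\<close>, and let \<open>\<phi>\<close> be a functional that reads off the coefficient of
\<open>u\<^bsup>m-1\<^esup> e\<close> of a vector in the cyclic subspace. The complement \<open>G\<close> is the largest invariant subspace of \<open>W\<close> on
which \<open>\<phi>\<close> vanishes. It meets the cyclic subspace trivially because the leading coefficient of a nonzero
\<open>p(u) e\<close> can be shifted to position \<open>m - 1\<close>. It is large enough because the \<open>m\<close> conditions
\<open>\<phi> (u\<^sup>i y) = 0\<close> with \<open>i < m\<close> imply all others, as \<open>P(u)\<close> kills \<open>W\<close>, and form a triangular system in the
coefficients of the correction \<open>p(u) e\<close>.
\<close>

lemma cyclic_complement:
  assumes W: "invariant W" "e \<in> W" and P: "annihilator e P" "lead_coeff P = 1"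
    and kill: "\<And>x. x \<in> W \<Longrightarrow> ev P x = 0"
  obtains G where "invariant G" "direct_sum W (cyclic e) G"
proof (cases "degree P = 0")
  case True
  \<comment> \<open>A constant annihilator forces \<open>e = 0\<close>; from degree one on there is a coefficient to read off.\<close>
  then obtain c where "P = [:c:]" by (rule degree_eq_zeroE)
  then have "P = 1" using P(2) by (simp add: one_pCons)
  have "e = 0" using annihilator_self[OF P(1)] \<open>P = 1\<close> by simp
  then have "cyclic e = {0}" by (auto simp: cyclic_def)
  moreover have "0 \<in> W" using W subspace_0 unfolding invariant_def by blast
  ultimately have "direct_sum W (cyclic e) W"
    using W unfolding direct_sum_def invariant_def by auto
  then show ?thesis using that W(1) by blast
next
  case False
  define m where "m = degree P"
  have m: "m > 0" using False m_def by simp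
  have Pnz: "P \<noteq> 0" using P(2) by auto
  have vsK: "vector_space ((*) :: 'k \<Rightarrow> 'k \<Rightarrow> 'k)" by unfold_locales (simp_all add: algebra_simps)
  have "Vector_Spaces.linear Polynomial.smult (*) (\<lambda>p. coeff (p mod P) (m - 1))"
    unfolding Vector_Spaces.linear_iff by (simp add: vector_space_smult vsK poly_mod_add_left mod_smult_left)
  moreover have "coeff (p mod P) (m - 1) = 0" if "ev p e = 0" for p
    using that P(1) unfolding annihilator_def by (simp add: mod_eq_0_iff_dvd)
  ultimately obtain \<phi> where \<phi>: "Vector_Spaces.linear scale (*) \<phi>" "\<And>p. \<phi> (ev p e) = coeff (p mod P) (m - 1)"
    using cyclic_linear_extension[of "(*)"] by blast
  interpret \<phi>: Vector_Spaces.linear scale "(*)" \<phi> by (rule \<phi>(1))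
  define G where "G = {y \<in> W. \<forall>f. \<phi> (ev f y) = 0}"
  have subW: "subspace W" using W unfolding invariant_def by blast
  have "\<phi> (ev f (u x)) = 0" if "\<forall>f. \<phi> (ev f x) = 0" for f x
    using that[rule_format, of "pCons 0 f"] by (simp add: ev_u)
  then have "invariant G"
    using W(1) subspace_0[OF subW] subspace_add[OF subW] subspace_scale[OF subW]
    unfolding invariant_def G_def subspace_def
    by (simp add: ev_vec_add ev_vec_scale \<phi>.add \<phi>.scale \<phi>.zero)
  have "y = 0" if "y \<in> cyclic e" "y \<in> G" for y
  proof -
    obtain q where q: "y = ev q e" using \<open>y \<in> cyclic e\<close> unfolding cyclic_def by blast
    define p where "p = q mod P"
    have "ev q e = ev (q div P * P + p) e" by (simp add: p_def)
    then have y: "y = ev p e" using q annihilator_self[OF P(1)] by (simp add: ev_mult)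
    have "p = 0"
    proof (rule ccontr)
      assume nz: "p \<noteq> 0"
      then have dp: "degree p < m" unfolding m_def p_def using degree_mod_less[OF Pnz] by blast
      define f where "f = monom (1::'k) (m - 1 - degree p)"
      have fnz: "f \<noteq> 0" by (simp add: f_def monom_eq_0_iff)
      have "degree (f * p) = m - 1"
      proof -
        have "degree f = m - 1 - degree p" unfolding f_def by (rule degree_monom_eq) simp
        then show ?thesis using dp nz fnz by (simp add: degree_mult_eq)
      qed
      then have "(f * p) mod P = f * p" using m by (intro mod_poly_less) (simp add: m_def)
      then have "\<phi> (ev f y) = coeff (f * p) (m - 1)" using \<phi>(2)[of "f * p"] y by (simp add: ev_mult)
      also have "\<dots> = lead_coeff (f * p)" using \<open>degree (f * p) = m - 1\<close> by simp
      also have "\<dots> = lead_coeff f * lead_coeff p" by (rule lead_coeff_mult)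
      also have "\<dots> \<noteq> 0" using nz fnz by simp
      finally show False using \<open>y \<in> G\<close> unfolding G_def by blast
    qed
    then show ?thesis using y by simp
  qed
  moreover have "0 \<in> cyclic e" "0 \<in> G"
    using invariant_cyclic \<open>invariant G\<close> unfolding invariant_def by (auto intro: subspace_0)
  ultimately have int: "cyclic e \<inter> G = {0}" by blast
  have proj: "\<exists>p. y - ev p e \<in> G" if y: "y \<in> W" for y
  proof -
    have "\<exists>p. \<forall>i<k. \<phi> ((u ^^ i) (y - ev p e)) = 0" if "k \<le> m" for k
      using that
    proof (induction k)
      case (Suc k)
      then obtain p where p: "\<forall>i<k. \<phi> ((u ^^ i) (y - ev p e)) = 0" by auto
      define c where "c = \<phi> ((u ^^ k) (y - ev p e))"
      let ?p = "p + monom c (m - 1 - k)"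
      have "\<phi> ((u ^^ i) (y - ev ?p e)) = 0" if i: "i \<le> k" for i
      proof -
        have "(u ^^ i) (y - ev ?p e) = (u ^^ i) (y - ev p e) - (u ^^ i) (ev (monom c (m - 1 - k)) e)"
          using ev_vec_diff[of "monom 1 i" "y - ev p e" "ev (monom c (m - 1 - k)) e"]
          by (simp add: ev_monom algebra_simps)
        also have "(u ^^ i) (ev (monom c (m - 1 - k)) e) = ev (monom c (i + (m - 1 - k))) e"
          using ev_mult[of "monom 1 i" "monom c (m - 1 - k)" e] by (simp add: ev_monom[of 1 i] mult_monom)
        finally have 1: "\<phi> ((u ^^ i) (y - ev ?p e))
            = \<phi> ((u ^^ i) (y - ev p e)) - coeff (monom c (i + (m - 1 - k)) mod P) (m - 1)"
          by (simp add: \<phi>.diff \<phi>(2))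
        have "degree (monom c (i + (m - 1 - k))) < degree P"
          using i Suc.prems m m_def by (intro le_less_trans[OF degree_monom_le]) linarith
        then have 2: "monom c (i + (m - 1 - k)) mod P = monom c (i + (m - 1 - k))"
          by (rule mod_poly_less)
        show ?thesis
        proof (cases "i = k")
          case True
          then show ?thesis using 1 2 Suc.prems by (simp add: c_def)
        next
          case False
          then have "i < k" using i by simp
          then show ?thesis using 1 2 Suc.prems p by simp
        qed
      qed
      then show ?case by (intro exI[of _ ?p]) (simp add: less_Suc_eq_le)
    qed simp
    then obtain p where p: "\<forall>i<m. \<phi> ((u ^^ i) (y - ev p e)) = 0" by blast
    define z where "z = y - ev p e"
    have zW: "z \<in> W" unfolding z_def
      using y invariant_ev[OF W] subW by (auto intro: subspace_diff)
    have "\<phi> (ev f z) = 0" for f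
    proof -
      have "ev f z = ev (f div P * P + f mod P) z" by simp
      also have "\<dots> = ev (f mod P) z" by (simp only: ev_add ev_mult kill[OF zW] ev_vec_zero add_0_left)
      finally have "ev f z = ev (f mod P) z" .
      also have "\<dots> = (\<Sum>i\<le>degree (f mod P). coeff (f mod P) i *s (u ^^ i) z)" by (simp add: poly_endo_def)
      also have "\<phi> \<dots> = (\<Sum>i\<le>degree (f mod P). coeff (f mod P) i * \<phi> ((u ^^ i) z))"
        by (simp add: \<phi>.sum \<phi>.scale)
      also have "\<dots> = 0"
      proof (rule sum.neutral, rule ballI)
        fix i assume "i \<in> {..degree (f mod P)}"
        moreover have "degree (f mod P) < m"
          using degree_mod_less'[OF Pnz, of f] m m_def by (cases "f mod P = 0") auto
        ultimately have "i < m" by simp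
        then show "coeff (f mod P) i * \<phi> ((u ^^ i) z) = 0" using p z_def by simp
      qed
      finally show ?thesis .
    qed
    then show ?thesis using zW unfolding G_def z_def by blast
  qed
  have "W \<subseteq> {x + y | x y. x \<in> cyclic e \<and> y \<in> G}"
  proof
    fix y assume "y \<in> W"
    then obtain p where "y - ev p e \<in> G" using proj by blast
    then show "y \<in> {x + y | x y. x \<in> cyclic e \<and> y \<in> G}"
      by (intro CollectI exI[of _ "ev p e"] exI[of _ "y - ev p e"]) simp
  qed
  moreover have "{x + y | x y. x \<in> cyclic e \<and> y \<in> G} \<subseteq> W"
    using cyclic_subset[OF W] subspace_add[OF subW] unfolding G_def by auto
  ultimately have "direct_sum W (cyclic e) G"
    using int invariant_cyclic \<open>invariant G\<close> unfolding direct_sum_def invariant_def by auto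
  then show ?thesis using that \<open>invariant G\<close> by blast
qed

section \<open>The rational canonical form\<close>

text \<open>
The list collects the annihilators of generators of a direct decomposition into cyclic subspaces. New
summands are appended at the end, which is the place of the largest invariant factor.
\<close>

inductive cyclic_decomposition :: "'e set \<Rightarrow> 'k poly list \<Rightarrow> bool" where
  empty: "cyclic_decomposition {0} []"
| snoc: "cyclic_decomposition W Ps \<Longrightarrow> annihilator e P \<Longrightarrow> direct_sum W' W (cyclic e) \<Longrightarrow>
    cyclic_decomposition W' (Ps @ [P])"

lemma annihilator_monic_degree_0:
  assumes "annihilator e P" "lead_coeff P = 1" "degree P = 0" shows "P = 1" "e = 0"
proof -
  obtain c where "P = [:c:]" using assms(3) by (rule degree_eq_zeroE)
  then show "P = 1" using assms(2) by (simp add: one_pCons)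
  then show "e = 0" using annihilator_self[OF assms(1)] by simp
qed

text \<open>
A maximal vector splits off a cyclic summand with an invariant complement. Its annihilator kills the
complement and is therefore divisible by all factors found there. The divisibility of every polynomial
that kills \<open>W\<close> identifies the factors of a nilpotent operator as powers of \<open>X\<close>.
\<close>

lemma exists_invariant_factors:
  assumes "invariant W"
  shows "\<exists>Ps. cyclic_decomposition W Ps \<and> sorted_wrt (dvd) Ps \<and>
    (\<forall>P\<in>set Ps. lead_coeff P = 1 \<and> degree P > 0 \<and> (\<forall>f. (\<forall>x\<in>W. ev f x = 0) \<longrightarrow> P dvd f))"
  using assms
proof (induction "dim W" arbitrary: W rule: less_induct)
  case less
  show ?case
  proof (cases "W = {0}")
    case True
    then show ?thesis by (intro exI[of _ "[]"]) (simp add: cyclic_decomposition.empty)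
  next
    case False
    moreover have "0 \<in> W" using less.prems subspace_0 unfolding invariant_def by blast
    ultimately obtain w where w: "w \<in> W" "w \<noteq> 0" by blast
    obtain e P where e: "e \<in> W" "annihilator e P" "lead_coeff P = 1" "\<And>x. x \<in> W \<Longrightarrow> ev P x = 0"
      using exists_maximal_vector[OF less.prems] by blast
    obtain G where G: "invariant G" "direct_sum W (cyclic e) G"
      using cyclic_complement[OF less.prems e] by blast
    have deg: "degree P > 0"
    proof (rule ccontr)
      assume "\<not> ?thesis"
      then have "P = 1" using annihilator_monic_degree_0[OF e(2,3)] by simp
      then show False using e(4)[OF w(1)] w(2) by simp
    qed
    have "e \<noteq> 0"
    proof
      assume "e = 0"
      then have "ev 1 e = 0" by simp
      then have "P dvd 1" using e(2) unfolding annihilator_def by blast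
      then have "ev 1 w = 0" using e(4)[OF w(1)] ev_dvd_eq_0 by blast
      then show False using w(2) by simp
    qed
    then have "dim (cyclic e) \<noteq> 0" unfolding dim_eq_0 using self_in_cyclic[of e] by blast
    then have "dim G < dim W" using direct_sum_dim[OF G(2)] by linarith
    then obtain Ps where Ps: "cyclic_decomposition G Ps" "sorted_wrt (dvd) Ps"
      "\<And>P. P \<in> set Ps \<Longrightarrow> lead_coeff P = 1 \<and> degree P > 0"
      "\<And>P f. P \<in> set Ps \<Longrightarrow> (\<forall>x\<in>G. ev f x = 0) \<Longrightarrow> P dvd f"
      using less.hyps[OF _ G(1)] by blast
    have GW: "G \<subseteq> W" using direct_sum_subset[OF G(2)] by blast
    have "cyclic_decomposition W (Ps @ [P])"
      by (rule cyclic_decomposition.snoc[OF Ps(1) e(2) direct_sum_sym[OF G(2)]])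
    moreover have "sorted_wrt (dvd) (Ps @ [P])"
      unfolding sorted_wrt_append using Ps(2) Ps(4)[of _ P] GW e(4) by auto
    moreover have "Q dvd f" if "Q \<in> set (Ps @ [P])" "\<forall>x\<in>W. ev f x = 0" for Q f
    proof (cases "Q \<in> set Ps")
      case True
      then show ?thesis using Ps(4)[of Q f] that(2) GW by blast
    next
      case False
      then have "Q = P" using that(1) by simp
      then show ?thesis using e(1,2) that(2) unfolding annihilator_def by blast
    qed
    ultimately show ?thesis using Ps(3) e(3) deg by (intro exI[of _ "Ps @ [P]"]) auto
  qed
qed

lemma represented_on_cyclic:
  assumes "annihilator e P" "lead_coeff P = 1"
  shows "represented_on scale (cyclic e) u (companion_mat P)"
proof -
  define m where "m = degree P"
  have Pnz: "P \<noteq> 0" using assms(2) by auto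
  let ?f = "\<lambda>i. (u ^^ i) e"
  have orb: "p = 0" if "degree p < m" "ev p e = 0" for p
  proof (rule ccontr)
    assume "p \<noteq> 0"
    moreover have "P dvd p" using that(2) assms(1) unfolding annihilator_def by blast
    ultimately have "degree P \<le> degree p" by (intro dvd_imp_degree_le)
    then show False using that(1) m_def by simp
  qed
  note ind = independent_orbit[of m e, OF orb]
  have "span (?f ` {..<m}) = cyclic e"
  proof (intro equalityI)
    have "(u ^^ i) e \<in> cyclic e" for i using cyclicI[of "monom 1 i" e] by (simp add: ev_monom del: cyclicI)
    then have "?f ` {..<m} \<subseteq> cyclic e" by blast
    then show "span (?f ` {..<m}) \<subseteq> cyclic e"
      using span_minimal invariant_cyclic unfolding invariant_def by blast
    have "ev p e \<in> span (?f ` {..<m})" for p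
    proof -
      have "ev p e = ev (p div P * P + p mod P) e" by simp
      also have "\<dots> = ev (p mod P) e"
        by (simp only: ev_add ev_mult annihilator_self[OF assms(1)] ev_vec_zero add_0_left)
      finally have eq: "ev p e = (\<Sum>i\<le>degree (p mod P). coeff (p mod P) i *s ?f i)"
        by (simp add: poly_endo_def)
      show ?thesis
      proof (cases "p mod P = 0")
        case False
        then have "degree (p mod P) < m" unfolding m_def using degree_mod_less[OF Pnz] by blast
        then show ?thesis unfolding eq
          by (intro span_sum span_scale span_base) auto
      qed (simp add: eq span_zero)
    qed
    then show "cyclic e \<subseteq> span (?f ` {..<m})" unfolding cyclic_def by blast
  qed
  moreover have "u (?f j) = (\<Sum>i<m. companion_mat P $$ (i, j) *s ?f i)" if "j < m" for j
  proof (cases "j = m - 1")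
    case True
    have "ev P e = (\<Sum>i<m. coeff P i *s ?f i) + ?f m"
      using assms(2) unfolding poly_endo_def m_def
      by (simp add: lessThan_Suc_atMost[symmetric])
    then have "?f m = - (\<Sum>i<m. coeff P i *s ?f i)"
      using annihilator_self[OF assms(1)] by (simp add: eq_neg_iff_add_eq_0 add.commute)
    also have "\<dots> = (\<Sum>i<m. companion_mat P $$ (i, j) *s ?f i)"
      using True that by (simp add: companion_mat_def Let_def m_def sum_negf)
    also have "?f m = u (?f j)" using True that by (cases m) auto
    finally show ?thesis .
  next
    case False
    then have "(\<Sum>i<m. companion_mat P $$ (i, j) *s ?f i) = (\<Sum>i<m. if i = Suc j then ?f i else 0)"
      using that by (intro sum.cong) (auto simp: companion_mat_def Let_def m_def)
    also have "\<dots> = ?f (Suc j)" using False that by (subst sum.delta) auto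
    finally show ?thesis by simp
  qed
  moreover have "companion_mat P \<in> carrier_mat m m"
    by (auto simp: companion_mat_def Let_def m_def)
  moreover have "distinct (map ?f [0..<m])" using ind(1) by (simp add: distinct_map atLeast0LessThan)
  moreover have "set (map ?f [0..<m]) = ?f ` {..<m}" by (simp add: atLeast0LessThan)
  ultimately show ?thesis unfolding represented_on_def
    using ind(2) by (intro exI[of _ "map ?f [0..<m]"]) simp
qed

lemma dim_cyclic:
  assumes "annihilator e P" "lead_coeff P = 1" shows "dim (cyclic e) = degree P"
proof -
  obtain bs where bs: "distinct bs" "independent (set bs)" "span (set bs) = cyclic e"
    "companion_mat P \<in> carrier_mat (length bs) (length bs)"
    using represented_on_cyclic[OF assms] unfolding represented_on_def by blast
  have "dim (cyclic e) = card (set bs)" using dim_span_eq_card_independent[OF bs(2)] bs(3) by simp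
  also have "\<dots> = length bs" using bs(1) by (rule distinct_card)
  also have "\<dots> = degree P" using carrier_matD(1)[OF bs(4)] by (simp add: companion_mat_def Let_def)
  finally show ?thesis .
qed

lemma represented_on_direct_sum:
  assumes A: "represented_on scale A u M" and B: "represented_on scale B u N"
    and W: "direct_sum W A B"
  shows "represented_on scale W u (four_block_mat M (0\<^sub>m (dim_row M) (dim_col N)) (0\<^sub>m (dim_row N) (dim_col M)) N)"
proof -
  obtain bs where bs: "distinct bs" "independent (set bs)" "span (set bs) = A"
    "M \<in> carrier_mat (length bs) (length bs)"
    "\<And>j. j < length bs \<Longrightarrow> u (bs ! j) = (\<Sum>i<length bs. M $$ (i, j) *s bs ! i)"
    using A unfolding represented_on_def by blast
  obtain cs where cs: "distinct cs" "independent (set cs)" "span (set cs) = B"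
    "N \<in> carrier_mat (length cs) (length cs)"
    "\<And>j. j < length cs \<Longrightarrow> u (cs ! j) = (\<Sum>i<length cs. N $$ (i, j) *s cs ! i)"
    using B unfolding represented_on_def by blast
  let ?F = "four_block_mat M (0\<^sub>m (dim_row M) (dim_col N)) (0\<^sub>m (dim_row N) (dim_col M)) N"
  note bases = direct_sum_bases[OF W bs(2,3) cs(2,3)]
  have dims: "dim_row M = length bs" "dim_col M = length bs" "dim_row N = length cs" "dim_col N = length cs"
    using bs(4) cs(4) by auto
  have "u ((bs @ cs) ! j) = (\<Sum>i<length bs + length cs. ?F $$ (i, j) *s (bs @ cs) ! i)"
    if j: "j < length bs + length cs" for j
  proof (cases "j < length bs")
    case True
    then show ?thesis using bs(5)[OF True]
      by (simp add: sum_lessThan_add dims nth_append)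
  next
    case False
    then have "j - length bs < length cs" using j by simp
    then show ?thesis using cs(5)[of "j - length bs"] False
      by (simp add: sum_lessThan_add dims nth_append)
  qed
  moreover have "?F \<in> carrier_mat (length bs + length cs) (length bs + length cs)"
    using four_block_carrier_mat[OF bs(4) cs(4)] by simp
  moreover have "distinct (bs @ cs)" using bs(1) cs(1) bases(1) by simp
  moreover have "independent (set (bs @ cs))" "span (set (bs @ cs)) = W" using bases(2,3) by simp_all
  ultimately show ?thesis unfolding represented_on_def length_append[of bs cs, symmetric] by blast
qed

lemma cyclic_decomposition_represented:
  assumes "cyclic_decomposition W Ps" "\<And>P. P \<in> set Ps \<Longrightarrow> lead_coeff P = 1"
  shows "represented_on scale W u (diag_block_mat (map companion_mat Ps))"
  using assms
proof (induction rule: cyclic_decomposition.induct)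
  case empty
  show ?case unfolding represented_on_def
    by (intro exI[of _ "[]"]) (simp add: independent_empty)
next
  case (snoc W Ps e P W')
  have Ps: "represented_on scale W u (diag_block_mat (map companion_mat Ps))"
    using snoc.IH snoc.prems by simp
  have P: "represented_on scale (cyclic e) u (companion_mat P)"
    using represented_on_cyclic[OF snoc.hyps(2)] snoc.prems by simp
  show ?case
    using represented_on_direct_sum[OF Ps P snoc.hyps(3)] by (simp only: map_append list.map diag_block_mat_last Let_def)
qed

text \<open>
The involution multiplies the \<open>i\<close>-th basis vector by a sign given by \<open>\<epsilon> i\<close>. As the matrix only connects
basis vectors of different sign, it anticommutes with \<open>u\<close>.
\<close>

lemma parity_involution:
  assumes M: "represented_on scale W u M"
    and \<epsilon>: "\<forall>i<dim_row M. \<forall>j<dim_row M. M $$ (i, j) \<noteq> 0 \<longrightarrow> \<epsilon> i \<noteq> (\<epsilon> j :: bool)"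
  shows "invariant W"
    "\<exists>j. Vector_Spaces.linear scale scale j \<and> (\<forall>x\<in>W. j x \<in> W \<and> j (j x) = x \<and> j (u x) = - u (j x))"
proof -
  interpret vector_space_pair scale scale by unfold_locales
  obtain bs where bs: "distinct bs" "independent (set bs)" "span (set bs) = W"
    "M \<in> carrier_mat (length bs) (length bs)"
    "\<And>j. j < length bs \<Longrightarrow> u (bs ! j) = (\<Sum>i<length bs. M $$ (i, j) *s bs ! i)"
    using M unfolding represented_on_def by blast
  let ?n = "length bs"
  have mem: "bs ! i \<in> W" if "i < ?n" for i using that bs(3) span_base nth_mem by blast
  have subW: "subspace W" using bs(3) subspace_span by blast
  have "u b \<in> W" if "b \<in> set bs" for b
    using that bs(5) by (auto simp: in_set_conv_nth intro!: subspace_sum[OF subW] subspace_scale[OF subW] mem)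
  then have "set bs \<subseteq> {x. u x \<in> W}" by blast
  moreover have "subspace {x. u x \<in> W}"
    using subspace_0[OF subW] subspace_add[OF subW] subspace_scale[OF subW]
    unfolding subspace_def by (simp add: u.add u.scale u.zero)
  ultimately have "W \<subseteq> {x. u x \<in> W}" using span_minimal bs(3) by blast
  then show "invariant W" unfolding invariant_def using subW by blast
  define sg where "sg i = (if \<epsilon> i then 1 else - 1 :: 'k)" for i
  have sg: "sg i * sg i = 1" for i by (simp add: sg_def)
  have flip: "sg i * M $$ (i, k) = - (sg k * M $$ (i, k))" if "i < ?n" "k < ?n" for i k
    using \<epsilon> that bs(4) by (cases "M $$ (i, k) = 0") (auto simp: sg_def)
  obtain j where j: "Vector_Spaces.linear scale scale j"
    "\<forall>b\<in>set bs. j b = sg (THE i. i < ?n \<and> bs ! i = b) *s b"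
    using linear_independent_extend[OF bs(2), of "\<lambda>b. sg (THE i. i < ?n \<and> bs ! i = b) *s b"] by blast
  interpret j: Vector_Spaces.linear scale scale j by (rule j(1))
  have jb: "j (bs ! i) = sg i *s bs ! i" if "i < ?n" for i
  proof -
    have "(THE k. k < ?n \<and> bs ! k = bs ! i) = i"
      using that bs(1) by (intro the_equality) (auto simp: nth_eq_iff_index_eq)
    then show ?thesis using j(2) that by simp
  qed
  have "set bs \<subseteq> {x. j x \<in> W \<and> j (j x) = x \<and> j (u x) = - u (j x)}"
  proof
    fix b assume "b \<in> set bs"
    then obtain k where k: "k < ?n" "b = bs ! k" by (auto simp: in_set_conv_nth)
    have "j b \<in> W" using k jb mem subspace_scale[OF subW] by simp
    moreover have "j (j b) = b" using k jb by (simp add: j.scale sg)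
    moreover have "j (u b) = - u (j b)"
    proof -
      have "j (u b) = (\<Sum>i<?n. (sg i * M $$ (i, k)) *s bs ! i)"
        using k by (simp add: bs(5) j.sum j.scale jb mult.commute)
      also have "\<dots> = (\<Sum>i<?n. - (sg k *s (M $$ (i, k) *s bs ! i)))"
        using flip k by (intro sum.cong) simp_all
      also have "\<dots> = - (sg k *s (\<Sum>i<?n. M $$ (i, k) *s bs ! i))"
        unfolding sum_negf scale_sum_right ..
      also have "\<dots> = - u (j b)" using k by (simp add: jb u.scale bs(5))
      finally show ?thesis .
    qed
    ultimately show "b \<in> {x. j x \<in> W \<and> j (j x) = x \<and> j (u x) = - u (j x)}" by blast
  qed
  moreover have "subspace {x. j x \<in> W \<and> j (j x) = x \<and> j (u x) = - u (j x)}"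
    using subspace_0[OF subW] subspace_add[OF subW] subspace_scale[OF subW]
    unfolding subspace_def by (simp add: u.add u.scale u.zero j.add j.scale j.zero)
  ultimately have "W \<subseteq> {x. j x \<in> W \<and> j (j x) = x \<and> j (u x) = - u (j x)}"
    using span_minimal bs(3) by blast
  then show "\<exists>j. Vector_Spaces.linear scale scale j \<and> (\<forall>x\<in>W. j x \<in> W \<and> j (j x) = x \<and> j (u x) = - u (j x))"
    using j(1) by blast
qed

section \<open>Operators anticommuting with u\<close>

text \<open>
With \<open>c = a\<^sup>2\<close> and \<open>W\<close> the whole space this is the condition to which the theorem is reduced. It depends
on \<open>a\<close> only through \<open>a\<^sup>2\<close>, so the eigenvalues \<open>a\<close> and \<open>- a\<close> may be exchanged.
\<close>

definition anticommuting_root :: "'k \<Rightarrow> 'e set \<Rightarrow> bool" where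
  "anticommuting_root c W \<longleftrightarrow> invariant W \<and> (\<exists>s. Vector_Spaces.linear scale scale s \<and>
    (\<forall>x\<in>W. s x \<in> W \<and> s (u x) = - u (s x) \<and> s (s x) = c *s x - u (u x)))"

lemma anticommuting_root_direct_sum:
  assumes A: "anticommuting_root c A" and B: "anticommuting_root c B" and W: "direct_sum W A B"
  shows "anticommuting_root c W"
proof -
  obtain a where a: "Vector_Spaces.linear scale scale a"
    "\<And>x. x \<in> A \<Longrightarrow> a x \<in> A \<and> a (u x) = - u (a x) \<and> a (a x) = c *s x - u (u x)"
    using A unfolding anticommuting_root_def by blast
  obtain b where b: "Vector_Spaces.linear scale scale b"
    "\<And>x. x \<in> B \<Longrightarrow> b x \<in> B \<and> b (u x) = - u (b x) \<and> b (b x) = c *s x - u (u x)"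
    using B unfolding anticommuting_root_def by blast
  obtain s where s: "Vector_Spaces.linear scale scale s" "\<And>x. x \<in> A \<Longrightarrow> s x = a x" "\<And>x. x \<in> B \<Longrightarrow> s x = b x"
    using direct_sum_linear_extension[OF W a(1) b(1)] by blast
  interpret s: Vector_Spaces.linear scale scale s by (rule s(1))
  have inv: "invariant A" "invariant B" using A B unfolding anticommuting_root_def by auto
  have Weq: "W = {x + y | x y. x \<in> A \<and> y \<in> B}" using W unfolding direct_sum_def by blast
  have "invariant W" unfolding Weq using inv by (rule invariant_sum)
  moreover have "s x \<in> W \<and> s (u x) = - u (s x) \<and> s (s x) = c *s x - u (u x)" if xW: "x \<in> W" for x
  proof -
    obtain y z where yz: "y \<in> A" "z \<in> B" "x = y + z" using direct_sumE[OF W xW] by blast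
    have u: "u y \<in> A" "u z \<in> B" using inv yz unfolding invariant_def by auto
    have "s x = a y + b z" using yz s(2,3) by (simp add: s.add)
    moreover from this have "s x \<in> W" unfolding Weq using a(2)[OF yz(1)] b(2)[OF yz(2)] by blast
    moreover have "s (u x) = a (u y) + b (u z)" using yz(3) u s(2,3) by (simp add: u.add s.add)
    moreover have "s (a y + b z) = a (a y) + b (b z)"
      using a(2)[OF yz(1)] b(2)[OF yz(2)] s(2,3) by (simp add: s.add)
    ultimately show ?thesis using a(2)[OF yz(1)] b(2)[OF yz(2)] yz(3)
      by (simp add: u.add scale_right_distrib)
  qed
  ultimately show ?thesis unfolding anticommuting_root_def using s(1) by blast
qed

lemma anticommuting_root_0: "anticommuting_root c {0}"
proof -
  have "Vector_Spaces.linear scale scale (\<lambda>x. 0)"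
    by (simp add: Vector_Spaces.linear_iff vector_space_axioms)
  moreover have "invariant {0}" unfolding invariant_def by (simp add: subspace_single_0 u.zero)
  ultimately show ?thesis unfolding anticommuting_root_def
    by (intro conjI exI[of _ "\<lambda>x. 0"]) (simp_all add: u.zero)
qed

text \<open>
\<open>s = (a + u) j\<close>, because \<open>(a + u) j (a + u) j = (a + u) (a - u) j\<^sup>2\<close>.
\<close>

lemma anticommuting_root_of_involution:
  assumes W: "invariant W" and j: "Vector_Spaces.linear scale scale j"
    and jW: "\<And>x. x \<in> W \<Longrightarrow> j x \<in> W \<and> j (j x) = x \<and> j (u x) = - u (j x)"
  shows "anticommuting_root (a * a) W"
proof -
  interpret j: Vector_Spaces.linear scale scale j by (rule j)
  define s where "s x = a *s j x + u (j x)" for x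
  have uW: "\<And>x. x \<in> W \<Longrightarrow> u x \<in> W" and subW: "subspace W" using W unfolding invariant_def by auto
  have "Vector_Spaces.linear scale scale s"
    unfolding s_def by (simp add: Vector_Spaces.linear_iff vector_space_axioms j.add j.scale u.add u.scale
        scale_right_distrib mult.commute algebra_simps)
  moreover have "s x \<in> W \<and> s (u x) = - u (s x) \<and> s (s x) = (a * a) *s x - u (u x)" if x: "x \<in> W" for x
  proof (intro conjI)
    show "s x \<in> W" unfolding s_def using x jW uW subW by (simp add: subspace_add subspace_scale)
    show "s (u x) = - u (s x)" unfolding s_def using jW[OF x] by (simp add: u.add u.scale u.neg)
    have "j (s x) = a *s x - u x"
      unfolding s_def using jW[OF x] jW[of "j x"] by (simp add: j.add j.scale)
    then show "s (s x) = (a * a) *s x - u (u x)"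
      unfolding s_def[of "s x"] by (simp add: u.diff u.scale scale_right_diff_distrib)
  qed
  ultimately show ?thesis unfolding anticommuting_root_def using W by blast
qed

text \<open>
The correspondence is \<open>s = a (p + q - 1)\<close>, with the inverse \<open>p = (a + s + u) / (2 a)\<close> and
\<open>q = (a + s - u) / (2 a)\<close>.
\<close>

lemma composite_iff_anticommuting_root:
  assumes a: "a \<noteq> 0" "(2::'k) \<noteq> 0"
  shows "composite scale a (- a) u \<longleftrightarrow> anticommuting_root (a * a) UNIV"
proof
  assume "composite scale a (- a) u"
  then obtain p q where p: "Vector_Spaces.linear scale scale p" "p \<circ> p = p"
    and q: "Vector_Spaces.linear scale scale q" "q \<circ> q = q" and upq: "u = (\<lambda>x. a *s p x + (- a) *s q x)"
    unfolding composite_def by blast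
  interpret p: Vector_Spaces.linear scale scale p by (rule p(1))
  interpret q: Vector_Spaces.linear scale scale q by (rule q(1))
  have pp: "p (p x) = p x" "q (q x) = q x" for x using p(2) q(2) by (metis comp_apply)+
  have ux: "u x = a *s (p x - q x)" for x by (simp add: upq scale_right_diff_distrib)
  define s where "s x = a *s (p x + q x - x)" for x
  have "Vector_Spaces.linear scale scale s"
    unfolding s_def by (simp add: Vector_Spaces.linear_iff vector_space_axioms p.add p.scale q.add q.scale
        scale_right_distrib scale_right_diff_distrib algebra_simps)
  moreover have "s (u x) = - u (s x)" for x
    unfolding s_def ux
    by (simp add: p.add q.add p.diff q.diff p.scale q.scale pp scale_right_distrib scale_right_diff_distrib)
  moreover have "s (s x) = (a * a) *s x - u (u x)" for x
    unfolding s_def ux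
    by (simp add: p.add q.add p.diff q.diff p.scale q.scale pp scale_right_distrib scale_right_diff_distrib)
  moreover have "invariant UNIV" unfolding invariant_def by simp
  ultimately show "anticommuting_root (a * a) UNIV" unfolding anticommuting_root_def by auto
next
  assume "anticommuting_root (a * a) UNIV"
  then obtain s where s: "Vector_Spaces.linear scale scale s"
    "\<And>x. s (u x) = - u (s x)" "\<And>x. s (s x) = (a * a) *s x - u (u x)"
    unfolding anticommuting_root_def by auto
  interpret s: Vector_Spaces.linear scale scale s by (rule s(1))
  define b where "b = inverse (2 * a)"
  have b: "b * a + b * a = 1" using a unfolding b_def by (simp add: field_simps)
  define p where "p x = b *s (a *s x + s x + u x)" for x
  define q where "q x = b *s (a *s x + s x - u x)" for x
  have "Vector_Spaces.linear scale scale p" "Vector_Spaces.linear scale scale q"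
    unfolding p_def q_def by (simp_all add: Vector_Spaces.linear_iff vector_space_axioms s.add s.scale u.add u.scale
        scale_right_distrib scale_right_diff_distrib algebra_simps)
  moreover have "p (p x) = p x" for x
  proof -
    define y where "y = a *s x + s x + u x"
    have y: "a *s y + s y + u y = a *s y + a *s y"
      unfolding y_def
      by (simp add: s.add s.scale u.add u.scale s(2,3) scale_right_distrib)
    have "p (p x) = b *s (b *s (a *s y + s y + u y))"
      unfolding p_def y_def[symmetric] by (simp add: s.scale u.scale scale_right_distrib mult.commute)
    also have "\<dots> = b *s ((b * a + b * a) *s y)" unfolding y by (simp only: scale_right_distrib scale_left_distrib scale_scale)
    also have "\<dots> = p x" by (simp add: b p_def y_def)
    finally show ?thesis .
  qed
  moreover have "q (q x) = q x" for x
  proof -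
    define y where "y = a *s x + s x - u x"
    have y: "a *s y + s y - u y = a *s y + a *s y"
      unfolding y_def
      by (simp add: s.add s.diff s.scale u.add u.diff u.scale s(2,3) scale_right_distrib scale_right_diff_distrib)
    have "q (q x) = b *s (b *s (a *s y + s y - u y))"
      unfolding q_def y_def[symmetric] by (simp add: s.scale u.scale scale_right_distrib scale_right_diff_distrib mult.commute)
    also have "\<dots> = b *s ((b * a + b * a) *s y)" unfolding y by (simp only: scale_right_distrib scale_left_distrib scale_scale)
    also have "\<dots> = q x" by (simp add: b q_def y_def)
    finally show ?thesis .
  qed
  moreover have "u x = a *s p x + (- a) *s q x" for x
  proof -
    have "a *s p x + (- a) *s q x = (b * a) *s u x + (b * a) *s u x"
      unfolding p_def q_def
      by (simp add: scale_right_distrib scale_right_diff_distrib mult.commute)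
    then show ?thesis unfolding scale_left_distrib[symmetric] b by simp
  qed
  ultimately show "composite scale a (- a) u"
    unfolding composite_def by (intro exI[of _ p] exI[of _ q]) (auto simp: fun_eq_iff)
qed

lemma anticommute_ev:
  assumes "invariant W" "Vector_Spaces.linear scale scale s"
    and s: "\<And>x. x \<in> W \<Longrightarrow> s (u x) = - u (s x)" and x: "x \<in> W"
  shows "s (ev P x) = ev (reflect P) (s x)"
proof -
  interpret s: Vector_Spaces.linear scale scale s by fact
  show ?thesis
  proof (induction P)
    case (pCons c P)
    have "s (ev (pCons c P) x) = c *s s x - u (s (ev P x))"
      using s[OF invariant_ev[OF assms(1) x]] by (simp add: s.add s.scale)
    then show ?case unfolding pCons.IH by (simp add: pcompose_pCons u.neg)
  qed (simp add: s.zero)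
qed

text \<open>
One Jordan block for \<open>b\<close> and one for \<open>- b\<close>, possibly of size zero. The map is given by
\<open>s (p(u) e) = p(-u) f\<close> and \<open>s (q(u) f) = (b\<^sup>2 - u\<^sup>2) q(-u) e\<close>. The first formula is consistent if
\<open>n \<le> m\<close>. The second is consistent if \<open>m \<le> n + 1\<close>, because \<open>b\<^sup>2 - X\<^sup>2\<close> contributes one
more factor \<open>X - b\<close>.
\<close>

lemma anticommuting_root_cyclic_pair:
  assumes e: "annihilator e ([:- b, 1:] ^ m)" and f: "annihilator f ([:b, 1:] ^ n)"
    and mn: "n \<le> m" "m \<le> n + 1" and Z: "direct_sum Z (cyclic e) (cyclic f)"
  shows "anticommuting_root (b * b) Z"
proof -
  let ?D = "[:b * b, 0, - 1:]"
  have D: "?D = [:b, 1:] * - [:- b, 1:]" by simp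
  have Ddvd: "[:- b, 1:] dvd ?D" unfolding D by (rule dvd_mult, subst dvd_minus_iff, rule dvd_refl)
  have rD: "reflect ?D = ?D" by (simp add: pcompose_pCons)
  have "Vector_Spaces.linear Polynomial.smult scale (\<lambda>p. ev (reflect p) f)"
    by (simp add: Vector_Spaces.linear_iff vector_space_smult vector_space_axioms pcompose_add pcompose_smult)
  moreover have "ev (reflect p) f = 0" if "ev p e = 0" for p
  proof -
    have "[:- b, 1:] ^ m dvd p" using e that unfolding annihilator_def by blast
    then have "[:b, 1:] ^ m dvd reflect p" by (rule reflect_linear_power_dvd)
    then have "[:b, 1:] ^ n dvd reflect p" using mn(1) le_imp_power_dvd dvd_trans by blast
    then show ?thesis using f unfolding annihilator_def by blast
  qed
  ultimately obtain s1 where s1: "Vector_Spaces.linear scale scale s1" "\<And>p. s1 (ev p e) = ev (reflect p) f"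
    using cyclic_linear_extension[of scale "\<lambda>p. ev (reflect p) f" e] by blast
  have "Vector_Spaces.linear Polynomial.smult scale (\<lambda>p. ev (?D * reflect p) e)"
    by (simp add: Vector_Spaces.linear_iff vector_space_smult vector_space_axioms pcompose_add pcompose_smult
        ring_distribs mult_smult_right del: mult_pCons_left)
  moreover have "ev (?D * reflect p) e = 0" if "ev p f = 0" for p
  proof -
    have "[:- (- b), 1:] ^ n dvd p" using f that unfolding annihilator_def by simp
    then have "[:- b, 1:] ^ n dvd reflect p" by (rule reflect_linear_power_dvd)
    with Ddvd have "[:- b, 1:] * [:- b, 1:] ^ n dvd ?D * reflect p" by (rule mult_dvd_mono)
    then have "[:- b, 1:] ^ Suc n dvd ?D * reflect p" by simp
    moreover have "[:- b, 1:] ^ m dvd [:- b, 1:] ^ Suc n" using mn(2) by (intro le_imp_power_dvd) simp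
    ultimately have "[:- b, 1:] ^ m dvd ?D * reflect p" by (rule dvd_trans[rotated])
    then show ?thesis using e unfolding annihilator_def by blast
  qed
  ultimately obtain s2 where s2: "Vector_Spaces.linear scale scale s2" "\<And>p. s2 (ev p f) = ev (?D * reflect p) e"
    using cyclic_linear_extension[of scale "\<lambda>p. ev (?D * reflect p) e" f] by blast
  obtain s where s: "Vector_Spaces.linear scale scale s"
    "\<And>x. x \<in> cyclic e \<Longrightarrow> s x = s1 x" "\<And>x. x \<in> cyclic f \<Longrightarrow> s x = s2 x"
    using direct_sum_linear_extension[OF Z s1(1) s2(1)] by blast
  interpret s: Vector_Spaces.linear scale scale s by (rule s(1))
  have Zeq: "Z = {x + y | x y. x \<in> cyclic e \<and> y \<in> cyclic f}" using Z unfolding direct_sum_def by blast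
  have spq: "s (ev p e + ev q f) = ev (?D * reflect q) e + ev (reflect p) f" for p q
    by (simp add: s.add s(2,3) s1(2) s2(2) add.commute del: mult_pCons_left)
  have "invariant Z" unfolding Zeq by (rule invariant_sum[OF invariant_cyclic invariant_cyclic])
  moreover have "s x \<in> Z \<and> s (u x) = - u (s x) \<and> s (s x) = (b * b) *s x - u (u x)" if x: "x \<in> Z" for x
  proof -
    obtain p q where pq: "x = ev p e + ev q f"
      using x unfolding Zeq cyclic_def by blast
    have sx: "s x = ev (?D * reflect q) e + ev (reflect p) f" unfolding pq by (rule spq)
    then have "s x \<in> Z" unfolding Zeq using cyclicI by blast
    moreover have "u x = ev (pCons 0 p) e + ev (pCons 0 q) f" unfolding pq by (simp add: u.add)
    then have "s (u x) = ev (?D * reflect (pCons 0 q)) e + ev (reflect (pCons 0 p)) f"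
      by (simp only: spq)
    then have "s (u x) = - u (s x)"
      unfolding sx by (simp add: pcompose_pCons ev_mult u.add u.diff u.scale u.neg ev_u ev_vec_neg algebra_simps del: mult_pCons_left)
    moreover have "s (s x) = ev (?D * reflect (reflect p)) e + ev (reflect (?D * reflect q)) f"
      unfolding sx by (rule spq)
    then have "s (s x) = ev ?D x"
      unfolding pcompose_mult rD reflect_reflect pq by (simp add: ev_mult ev_vec_add del: mult_pCons_left ev_pCons)
    then have "s (s x) = (b * b) *s x - u (u x)" by (simp add: u.neg u.zero)
    ultimately show ?thesis by blast
  qed
  ultimately show ?thesis unfolding anticommuting_root_def using s(1) by blast
qed

text \<open>
This serves the even factors and the factors \<open>X\<^sup>m\<close> of the nilpotent part alike.
\<close>

lemma anticommuting_root_of_parity: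
  assumes "represented_on scale W u (diag_block_mat (map companion_mat Ps))"
    and "\<And>P i. P \<in> set Ps \<Longrightarrow> i < degree P \<Longrightarrow> coeff P i \<noteq> 0 \<Longrightarrow> even (degree P - i)"
  shows "anticommuting_root (a * a) W"
proof -
  have "dim_row (diag_block_mat (map companion_mat Ps)) = sum_list (map degree Ps)"
    by (simp add: dim_diag_block_mat companion_mat_def Let_def o_def)
  then obtain \<epsilon> :: "nat \<Rightarrow> bool" where
    "\<forall>i<dim_row (diag_block_mat (map companion_mat Ps)). \<forall>j<dim_row (diag_block_mat (map companion_mat Ps)).
      diag_block_mat (map companion_mat Ps) $$ (i, j) \<noteq> 0 \<longrightarrow> \<epsilon> i \<noteq> \<epsilon> j"
    using diag_block_companion_parity[of Ps, OF assms(2)] by auto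
  note inv = parity_involution[OF assms(1) this]
  then obtain j where "Vector_Spaces.linear scale scale j"
    "\<And>x. x \<in> W \<Longrightarrow> j x \<in> W \<and> j (j x) = x \<and> j (u x) = - u (j x)" by blast
  then show ?thesis using anticommuting_root_of_involution[OF inv(1)] by blast
qed

lemma anticommuting_root_nilpotent:
  assumes W: "invariant W" and nil: "\<And>x. x \<in> W \<Longrightarrow> ev ([:0, 1:] ^ N) x = 0"
  shows "anticommuting_root (a * a) W"
proof -
  obtain Ps where Ps: "cyclic_decomposition W Ps"
    "\<And>P. P \<in> set Ps \<Longrightarrow> lead_coeff P = 1"
    "\<And>P f. P \<in> set Ps \<Longrightarrow> (\<forall>x\<in>W. ev f x = 0) \<Longrightarrow> P dvd f"
    using exists_invariant_factors[OF W] by blast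
  have "even (degree P - i)" if P: "P \<in> set Ps" "i < degree P" "coeff P i \<noteq> 0" for P i
  proof -
    have "P dvd [:- 0, 1:] ^ N" using Ps(3)[OF P(1)] nil by simp
    then obtain m where "P = [:- 0, 1:] ^ m" using monic_dvd_linear_power Ps(2)[OF P(1)] by blast
    then have "P = monom 1 m" by (simp add: monom_altdef)
    then show ?thesis using P(2,3) by (simp add: degree_monom_eq)
  qed
  then show ?thesis using anticommuting_root_of_parity cyclic_decomposition_represented[OF Ps(1,2)] by blast
qed

section \<open>Intertwined Jordan structures\<close>

definition ker_dim :: "'k \<Rightarrow> 'e set \<Rightarrow> nat \<Rightarrow> nat" where
  "ker_dim l V k = dim (V \<inter> {x. ev ([:- l, 1:] ^ k) x = 0})"

text \<open>
For invariant \<open>V\<close> this is the number \<open>n\<^sub>k\<close> of the restriction of \<open>u\<close> to \<open>V\<close>: it counts the Jordan blocks for \<open>l\<close> in \<open>V\<close> of size at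
least \<open>k\<close>.
\<close>

definition ker_jump :: "'k \<Rightarrow> 'e set \<Rightarrow> nat \<Rightarrow> int" where
  "ker_jump l V k = int (ker_dim l V k) - int (ker_dim l V (k - 1))"

lemma ker_jump_nonneg: "ker_jump l V k \<ge> 0"
proof -
  have "ev ([:- l, 1:] ^ k) x = 0" if "ev ([:- l, 1:] ^ (k - 1)) x = 0" for x
    by (rule ev_dvd_eq_0[OF _ that]) (simp add: le_imp_power_dvd)
  then have "ker_dim l V (k - 1) \<le> ker_dim l V k"
    unfolding ker_dim_def by (intro dim_subset) blast
  then show ?thesis unfolding ker_jump_def by simp
qed

lemma direct_sum_kernel:
  assumes W: "direct_sum W A B" and A: "invariant A" and B: "invariant B"
  shows "direct_sum (W \<inter> {x. ev P x = 0}) (A \<inter> {x. ev P x = 0}) (B \<inter> {x. ev P x = 0})"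
proof -
  let ?K = "{x. ev P x = 0}"
  have AB: "A \<inter> B = {0}" and Weq: "W = {x + y | x y. x \<in> A \<and> y \<in> B}" using W unfolding direct_sum_def by auto
  have "subspace (A \<inter> ?K)" "subspace (B \<inter> ?K)"
    using A B invariant_kernel_ev[of P] unfolding invariant_def by (auto intro: subspace_inter)
  moreover have "(A \<inter> ?K) \<inter> (B \<inter> ?K) = (A \<inter> B) \<inter> ?K" by blast
  then have "(A \<inter> ?K) \<inter> (B \<inter> ?K) = {0}" unfolding AB by auto
  moreover have "W \<inter> ?K = {x + y | x y. x \<in> A \<inter> ?K \<and> y \<in> B \<inter> ?K}"
  proof (intro equalityI subsetI)
    fix z assume z: "z \<in> W \<inter> ?K"
    then obtain x y where xy: "x \<in> A" "y \<in> B" "z = x + y" unfolding Weq by blast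
    have "ev P x + ev P y = 0" using z xy(3) by (simp add: ev_vec_add)
    then have "ev P x = 0 \<and> ev P y = 0"
      using direct_sum_eq_0[OF W] invariant_ev[OF A xy(1)] invariant_ev[OF B xy(2)] by blast
    then show "z \<in> {x + y | x y. x \<in> A \<inter> ?K \<and> y \<in> B \<inter> ?K}" using xy by blast
  next
    fix z assume "z \<in> {x + y | x y. x \<in> A \<inter> ?K \<and> y \<in> B \<inter> ?K}"
    then show "z \<in> W \<inter> ?K" unfolding Weq by (auto simp: ev_vec_add)
  qed
  ultimately show ?thesis unfolding direct_sum_def by blast
qed

lemma monic_linear_power: "lead_coeff ([:- l, 1:] ^ m) = (1::'k)" "degree ([:- l, 1:] ^ m) = m"
  by (simp only: lead_coeff_power, simp) (rule degree_linear_power)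

lemma ker_dim_cyclic:
  assumes e: "annihilator e ([:- l, 1:] ^ m)"
  shows "ker_dim l (cyclic e) k = min k m"
proof (cases "k \<le> m")
  case True
  let ?L = "[:- l, 1:]" and ?e = "ev ([:- l, 1:] ^ (m - k)) e"
  have Lnz: "?L ^ i \<noteq> 0" for i by simp
  have Lm: "?L ^ m = ?L ^ (m - k) * ?L ^ k" using True by (simp add: power_add[symmetric])
  have e': "annihilator ?e (?L ^ k)"
    using e Lnz unfolding Lm by (intro annihilator_ev)
  have "cyclic e \<inter> {x. ev (?L ^ k) x = 0} = cyclic ?e"
  proof (intro equalityI subsetI)
    fix x assume x: "x \<in> cyclic e \<inter> {x. ev (?L ^ k) x = 0}"
    then obtain p where p: "x = ev p e" unfolding cyclic_def by blast
    then have "ev (?L ^ k * p) e = 0" using x by (simp add: ev_mult)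
    then have "?L ^ k * ?L ^ (m - k) dvd ?L ^ k * p" using e Lm unfolding annihilator_def by (simp add: mult.commute)
    then have "?L ^ (m - k) dvd p" using Lnz by (simp only: dvd_times_left_cancel_iff[OF Lnz])
    then obtain r where "p = ?L ^ (m - k) * r" by blast
    then have "x = ev r ?e" using p by (simp add: ev_mult ev_commute[of r])
    then show "x \<in> cyclic ?e" by simp
  next
    fix x assume "x \<in> cyclic ?e"
    then obtain r where r: "x = ev r ?e" unfolding cyclic_def by blast
    then have "x = ev (r * ?L ^ (m - k)) e" by (simp add: ev_mult)
    then have "x \<in> cyclic e" by simp
    moreover have "ev (?L ^ k) x = ev r (ev (?L ^ k) ?e)" unfolding r by (rule ev_commute)
    then have "ev (?L ^ k) x = 0" using annihilator_self[OF e'] by simp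
    ultimately show "x \<in> cyclic e \<inter> {x. ev (?L ^ k) x = 0}" by blast
  qed
  then show ?thesis unfolding ker_dim_def
    using dim_cyclic[OF e' monic_linear_power(1)] True monic_linear_power(2)[of l k] by simp
next
  case False
  have "ev ([:- l, 1:] ^ k) x = 0" if x: "x \<in> cyclic e" for x
  proof -
    obtain p where "x = ev p e" using x unfolding cyclic_def by blast
    then have "ev ([:- l, 1:] ^ m) x = ev p (ev ([:- l, 1:] ^ m) e)" by (simp add: ev_commute)
    then have "ev ([:- l, 1:] ^ m) x = 0" using annihilator_self[OF e] by simp
    moreover have "[:- l, 1:] ^ m dvd [:- l, 1:] ^ k" using False by (intro le_imp_power_dvd) simp
    ultimately show ?thesis using ev_dvd_eq_0 by blast
  qed
  then have "cyclic e \<inter> {x. ev ([:- l, 1:] ^ k) x = 0} = cyclic e" by blast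
  then show ?thesis unfolding ker_dim_def
    using dim_cyclic[OF e monic_linear_power(1)] False monic_linear_power(2)[of l m] by simp
qed

text \<open>
The cyclic subspace of a maximal vector is a longest Jordan block. Splitting it off lowers the first \<open>m\<close>
jumps by one.
\<close>

lemma exists_longest_chain:
  assumes V: "invariant V" and nil: "\<And>x. x \<in> V \<Longrightarrow> ev ([:- l, 1:] ^ N) x = 0"
  obtains e m G where "annihilator e ([:- l, 1:] ^ m)" "direct_sum V (cyclic e) G" "invariant G"
    "\<And>k. k \<ge> 1 \<Longrightarrow> ker_jump l V k = (if k \<le> m then 1 else 0) + ker_jump l G k"
    "\<And>k. k > m \<Longrightarrow> ker_jump l V k = 0" "m = 0 \<Longrightarrow> V = {0}"
proof -
  let ?L = "[:- l, 1:]"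
  obtain e P where e: "e \<in> V" "annihilator e P" "lead_coeff P = 1" "\<And>x. x \<in> V \<Longrightarrow> ev P x = 0"
    using exists_maximal_vector[OF V] by blast
  have "P dvd ?L ^ N" using e(1,2) nil unfolding annihilator_def by blast
  then obtain m where m: "P = ?L ^ m" using monic_dvd_linear_power e(3) by blast
  obtain G where G: "invariant G" "direct_sum V (cyclic e) G"
    using cyclic_complement[OF V e] by blast
  have em: "annihilator e (?L ^ m)" using e(2) m by simp
  have dims: "ker_dim l V k = min k m + ker_dim l G k" for k
    using direct_sum_dim[OF direct_sum_kernel[OF G(2) invariant_cyclic G(1)], of "?L ^ k"]
      ker_dim_cyclic[OF em, of k] unfolding ker_dim_def by simp
  have jump: "ker_jump l V k = (if k \<le> m then 1 else 0) + ker_jump l G k" if "k \<ge> 1" for k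
    using that unfolding ker_jump_def dims by auto
  have "V \<inter> {x. ev (?L ^ k) x = 0} = V" if "k \<ge> m" for k
  proof -
    have "?L ^ m dvd ?L ^ k" using that by (rule le_imp_power_dvd)
    then show ?thesis using e(4) m ev_dvd_eq_0 by blast
  qed
  then have zero: "ker_jump l V k = 0" if "k > m" for k
    using that unfolding ker_jump_def ker_dim_def by simp
  have V0: "V = {0}" if "m = 0"
  proof -
    have "x = 0" if "x \<in> V" for x using e(4)[OF that] m \<open>m = 0\<close> by simp
    then show ?thesis using e(1) by blast
  qed
  show ?thesis by (rule that[OF em G(2) G(1) jump zero V0])
qed

lemma direct_sum_regroup:
  assumes Z: "direct_sum Z V W" and V: "direct_sum V C G" and W: "direct_sum W D H"
  defines "CD \<equiv> {x + y | x y. x \<in> C \<and> y \<in> D}" and "GH \<equiv> {x + y | x y. x \<in> G \<and> y \<in> H}"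
  shows "direct_sum CD C D" "direct_sum GH G H" "direct_sum Z CD GH"
proof -
  have sub: "subspace C" "subspace D" "subspace G" "subspace H"
    using V W unfolding direct_sum_def by auto
  have VW: "V \<inter> W = {0}" using Z unfolding direct_sum_def by blast
  note s = direct_sum_subset[OF V] direct_sum_subset[OF W]
  have "C \<inter> D = {0}" "G \<inter> H = {0}"
    using VW s sub[THEN subspace_0] by blast+
  then show 1: "direct_sum CD C D" and 2: "direct_sum GH G H"
    unfolding direct_sum_def CD_def GH_def using sub by auto
  have sub2: "subspace CD" "subspace GH" using 1 2 direct_sum_subspace by auto
  have "CD \<inter> GH = {0}"
  proof (intro equalityI subsetI)
    fix z assume "z \<in> CD \<inter> GH"
    then obtain c d g h where z: "z = c + d" "z = g + h" "c \<in> C" "d \<in> D" "g \<in> G" "h \<in> H"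
      unfolding CD_def GH_def by blast
    have "(c - g) + (d - h) = 0" using z(1,2) by (simp add: algebra_simps)
    moreover have "c - g \<in> V" "d - h \<in> W"
      using z s direct_sum_subspace[OF V] direct_sum_subspace[OF W] by (blast intro: subspace_diff)+
    ultimately have "c - g = 0" "d - h = 0" using direct_sum_eq_0[OF Z] by blast+
    then have "c \<in> C \<inter> G" using z by simp
    moreover have "d \<in> D \<inter> H" using z \<open>d - h = 0\<close> by simp
    ultimately have "c = 0" "d = 0" using V W unfolding direct_sum_def by auto
    then show "z \<in> {0}" using z(1) by simp
  qed (use sub2[THEN subspace_0] in auto)
  moreover have "Z = {x + y | x y. x \<in> CD \<and> y \<in> GH}"
  proof (intro equalityI subsetI)
    fix z assume "z \<in> Z"
    then obtain v w where vw: "v \<in> V" "w \<in> W" "z = v + w" using direct_sumE[OF Z \<open>z \<in> Z\<close>] by blast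
    obtain c g where cg: "c \<in> C" "g \<in> G" "v = c + g" using direct_sumE[OF V vw(1)] by blast
    obtain d h where dh: "d \<in> D" "h \<in> H" "w = d + h" using direct_sumE[OF W vw(2)] by blast
    have "z = (c + d) + (g + h)" using vw(3) cg(3) dh(3) by (simp add: algebra_simps)
    then show "z \<in> {x + y | x y. x \<in> CD \<and> y \<in> GH}" unfolding CD_def GH_def using cg dh by blast
  next
    fix z assume "z \<in> {x + y | x y. x \<in> CD \<and> y \<in> GH}"
    then obtain c d g h where z: "z = (c + d) + (g + h)" "c \<in> C" "d \<in> D" "g \<in> G" "h \<in> H"
      unfolding CD_def GH_def by blast
    have "z = (c + g) + (d + h)" using z(1) by (simp add: algebra_simps)
    moreover have "c + g \<in> V" "d + h \<in> W" using z V W unfolding direct_sum_def by blast+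
    ultimately show "z \<in> Z" using Z unfolding direct_sum_def by blast
  qed
  ultimately show "direct_sum Z CD GH" unfolding direct_sum_def using sub2 by blast
qed

text \<open>
The longest Jordan blocks of \<open>V\<close> and \<open>W\<close> are split off together. By intertwining, their sizes \<open>m\<close> and \<open>n\<close>
differ by at most one, so \<open>anticommuting_root_cyclic_pair\<close> applies to them. The remaining jumps are still
intertwined: an inequality could only fail at an index \<open>k\<close> with \<open>m < k + 1\<close> and \<open>k \<le> n\<close> (or the
mirror image), where the left-hand side has already vanished.
\<close>

lemma anticommuting_root_intertwined:
  assumes "invariant V" "invariant W" "direct_sum Z V W"
    and "\<And>x. x \<in> V \<Longrightarrow> ev ([:- b, 1:] ^ N) x = 0" "\<And>x. x \<in> W \<Longrightarrow> ev ([:b, 1:] ^ N) x = 0"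
    and "\<And>k. k \<ge> 1 \<Longrightarrow> ker_jump b V (k + 1) \<le> ker_jump (- b) W k"
    and "\<And>k. k \<ge> 1 \<Longrightarrow> ker_jump (- b) W (k + 1) \<le> ker_jump b V k"
  shows "anticommuting_root (b * b) Z"
  using assms
proof (induction "dim Z" arbitrary: V W Z rule: less_induct)
  case less
  obtain e m G where e: "annihilator e ([:- b, 1:] ^ m)" "direct_sum V (cyclic e) G" "invariant G"
    "\<And>k. k \<ge> 1 \<Longrightarrow> ker_jump b V k = (if k \<le> m then 1 else 0) + ker_jump b G k"
    "\<And>k. k > m \<Longrightarrow> ker_jump b V k = 0" "m = 0 \<Longrightarrow> V = {0}"
    using exists_longest_chain[OF less.prems(1,4)] by blast
  have nilW: "ev ([:- (- b), 1:] ^ N) x = 0" if "x \<in> W" for x using less.prems(5)[OF that] by simp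
  obtain f n H where f: "annihilator f ([:- (- b), 1:] ^ n)" "direct_sum W (cyclic f) H" "invariant H"
    "\<And>k. k \<ge> 1 \<Longrightarrow> ker_jump (- b) W k = (if k \<le> n then 1 else 0) + ker_jump (- b) H k"
    "\<And>k. k > n \<Longrightarrow> ker_jump (- b) W k = 0" "n = 0 \<Longrightarrow> W = {0}"
    using exists_longest_chain[OF less.prems(2) nilW] by blast
  show ?case
  proof (cases "m = 0 \<and> n = 0")
    case True
    then have "Z = {0}" using e(6) f(6) less.prems(3) unfolding direct_sum_def by auto
    then show ?thesis using anticommuting_root_0 by simp
  next
    case False
    let ?C = "{x + y | x y. x \<in> cyclic e \<and> y \<in> cyclic f}" and ?G = "{x + y | x y. x \<in> G \<and> y \<in> H}"
    note regroup = direct_sum_regroup[OF less.prems(3) e(2) f(2)]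
    have mn: "m \<le> n + 1"
    proof (rule ccontr)
      assume "\<not> ?thesis"
      then have "m - 1 \<ge> 1" "m - 1 > n" by auto
      then have "ker_jump b V (m - 1 + 1) \<le> 0" using less.prems(6)[of "m - 1"] f(5) by simp
      moreover have "ker_jump b V m \<ge> 1"
        using e(4)[of m] ker_jump_nonneg[of b G m] \<open>m - 1 \<ge> 1\<close> by simp
      ultimately show False using \<open>m - 1 \<ge> 1\<close> by simp
    qed
    have nm: "n \<le> m + 1"
    proof (rule ccontr)
      assume "\<not> ?thesis"
      then have "n - 1 \<ge> 1" "n - 1 > m" by auto
      then have "ker_jump (- b) W (n - 1 + 1) \<le> 0" using less.prems(7)[of "n - 1"] e(5) by simp
      moreover have "ker_jump (- b) W n \<ge> 1"
        using f(4)[of n] ker_jump_nonneg[of "- b" H n] \<open>n - 1 \<ge> 1\<close> by simp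
      ultimately show False using \<open>n - 1 \<ge> 1\<close> by simp
    qed
    have fb: "annihilator f ([:b, 1:] ^ n)" using f(1) by simp
    have "anticommuting_root (b * b) ?C"
    proof (cases "n \<le> m")
      case True
      then show ?thesis using anticommuting_root_cyclic_pair[OF e(1) fb _ mn regroup(1)] by blast
    next
      case False
      \<comment> \<open>The block for \<open>- b\<close> is the longer one, so the two blocks exchange their roles.\<close>
      then have "anticommuting_root ((- b) * (- b)) ?C"
        using f(1) e(1) nm by (intro anticommuting_root_cyclic_pair[OF _ _ _ _ direct_sum_sym[OF regroup(1)]]) auto
      then show ?thesis by simp
    qed
    moreover have "anticommuting_root (b * b) ?G"
    proof (rule less.hyps[OF _ e(3) f(3) regroup(2)])
      have "dim (cyclic e) = m" "dim (cyclic f) = n"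
        using dim_cyclic[OF e(1) monic_linear_power(1)] dim_cyclic[OF f(1) monic_linear_power(1)]
        by (simp_all only: monic_linear_power(2))
      then have "dim ?C > 0" using direct_sum_dim[OF regroup(1)] False by linarith
      then show "dim ?G < dim Z" using direct_sum_dim[OF regroup(3)] by linarith
      have GV: "G \<subseteq> V" "H \<subseteq> W" using direct_sum_subset[OF e(2)] direct_sum_subset[OF f(2)] by auto
      show "ev ([:- b, 1:] ^ N) x = 0" if "x \<in> G" for x using that GV less.prems(4) by blast
      show "ev ([:b, 1:] ^ N) x = 0" if "x \<in> H" for x using that GV less.prems(5) by blast
      fix k :: nat assume k: "k \<ge> 1"
      show "ker_jump b G (k + 1) \<le> ker_jump (- b) H k"
        using less.prems(6)[OF k] e(4)[of "k + 1"] e(5)[of "k + 1"] f(4)[OF k]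
          ker_jump_nonneg[of "- b" H k] k by (auto split: if_splits)
      show "ker_jump (- b) H (k + 1) \<le> ker_jump b G k"
        using less.prems(7)[OF k] f(4)[of "k + 1"] f(5)[of "k + 1"] e(4)[OF k]
          ker_jump_nonneg[of b G k] k by (auto split: if_splits)
    qed
    ultimately show ?thesis using anticommuting_root_direct_sum regroup(3) by blast
  qed
qed

lemma n_seq_eq_ker_jump: "n_seq scale u l k = ker_jump l UNIV k"
proof -
  have "((\<lambda>x. u x - l *s x) ^^ k) x = ev ([:- l, 1:] ^ k) x" for k x
  proof (induction k)
    case (Suc k)
    have "ev ([:- l, 1:] ^ Suc k) x = ev [:- l, 1:] (ev ([:- l, 1:] ^ k) x)"
      by (simp only: power_Suc ev_mult)
    then show ?case using Suc by (simp add: u.zero)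
  qed simp
  then show ?thesis unfolding n_seq_def ker_jump_def ker_dim_def kernel_def by simp
qed

lemma anticommute_kernel_swap:
  assumes s: "Vector_Spaces.linear scale scale s" "\<And>x. s (u x) = - u (s x)"
    and x: "ev ([:- b, 1:] ^ k) x = 0"
  shows "ev ([:b, 1:] ^ k) (s x) = 0"
proof -
  interpret s: Vector_Spaces.linear scale scale s by (rule s(1))
  have "invariant UNIV" unfolding invariant_def by simp
  then have "ev (reflect ([:- b, 1:] ^ k)) (s x) = s (ev ([:- b, 1:] ^ k) x)"
    using anticommute_ev[of UNIV s x] s by simp
  then have "ev ((- [:b, 1:]) ^ k) (s x) = 0" using x unfolding reflect_linear_power by (simp only: s.zero)
  moreover have "(- [:b, 1:]) ^ k dvd [:b, 1:] ^ k" by (rule dvd_power_same) (subst minus_dvd_iff, rule dvd_refl)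
  ultimately show ?thesis using ev_dvd_eq_0 by blast
qed

text \<open>
Let \<open>V\<^sub>k\<close> and \<open>W\<^sub>k\<close> be the kernels of \<open>(u - b)\<^sup>k\<close> and \<open>(u + b)\<^sup>k\<close>. Between \<open>W\<^sub>k\<close> and \<open>W\<^bsub>k+1\<^esub>\<close> lies the
space \<open>Y\<^sub>k\<close> of all \<open>y\<close> in \<open>W\<^bsub>k+1\<^esub>\<close> with \<open>s y\<close> in \<open>V\<^sub>k\<close>. The map \<open>s\<close> embeds
\<open>V\<^bsub>k+1\<^esub> / V\<^sub>k\<close> into \<open>Y\<^sub>k / Y\<^bsub>k-1\<^esub>\<close>, since \<open>s\<^sup>2\<close> is \<open>u - b\<close> up to an invertible factor on \<open>V\<^bsub>k+1\<^esub>\<close>; and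
\<open>u + b\<close> embeds \<open>Y\<^sub>k / W\<^sub>k\<close> into \<open>Y\<^bsub>k-1\<^esub> / W\<^bsub>k-1\<^esub>\<close>. The two resulting inequalities between dimensions add up
to the claim.
\<close>

lemma anticommuting_root_ker_jump_le:
  assumes s: "Vector_Spaces.linear scale scale s" "\<And>x. s (u x) = - u (s x)"
    "\<And>x. s (s x) = (b * b) *s x - u (u x)"
    and b: "b \<noteq> 0" "(2::'k) \<noteq> 0" and k: "k \<ge> 1"
  shows "ker_jump b UNIV (k + 1) \<le> ker_jump (- b) UNIV k"
proof -
  interpret s: Vector_Spaces.linear scale scale s by (rule s(1))
  obtain i where i: "k = Suc i" using k by (cases k) auto
  define L where "L = [:- b, 1:]"
  define M where "M = [:b, 1:]"
  define V where "V k = {x. ev (L ^ k) x = 0}" for k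
  define W where "W k = {x. ev (M ^ k) x = 0}" for k
  define Y where "Y k = {y \<in> W (Suc k). s y \<in> V k}" for k
  have subV: "subspace (V k)" and subW: "subspace (W k)" for k
    unfolding V_def W_def using invariant_kernel_ev unfolding invariant_def by blast+
  have subY: "subspace (Y k)" for k
    using subspace_0[OF subW[of "Suc k"]] subspace_0[OF subV[of k]] subspace_add[OF subW[of "Suc k"]]
      subspace_add[OF subV[of k]] subspace_scale[OF subW[of "Suc k"]] subspace_scale[OF subV[of k]]
    unfolding Y_def subspace_def by (simp add: s.add s.scale s.zero)
  have mono: "V k \<subseteq> V (Suc k)" "W k \<subseteq> W (Suc k)" for k
    unfolding V_def W_def using ev_dvd_eq_0[OF le_imp_power_dvd[OF le_SucI[OF order_refl]]] by blast+
  have sV: "s x \<in> W k" if "x \<in> V k" for x k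
    using that anticommute_kernel_swap[OF s(1,2), of b k x] unfolding V_def W_def L_def M_def by simp
  have sW: "s x \<in> V k" if "x \<in> W k" for x k
    using that anticommute_kernel_swap[OF s(1,2), of "- b" k x] unfolding V_def W_def L_def M_def by simp
  have ss: "s (s x) = - ev M (ev L x)" for x
    by (simp add: s(3) L_def M_def u.zero u.add u.diff u.scale u.neg scale_right_distrib scale_right_diff_distrib)
  have ssV: "s (s x) \<in> V k" if "x \<in> V (Suc k)" for x k
  proof -
    have "ev (L ^ k) (ev M (ev L x)) = ev M (ev (L ^ Suc k) x)"
      unfolding ev_mult[symmetric] by (simp only: power_Suc mult_ac)
    then show ?thesis using that unfolding V_def ss by (simp add: ev_vec_neg)
  qed
  have co: "comaximal L M"
    unfolding L_def by (rule comaximal_linear_if_no_root) (use b in \<open>simp add: M_def mult_2[symmetric]\<close>)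
  have "dim (V (Suc (Suc i))) + dim (Y i) \<le> dim (V (Suc i)) + dim (Y (Suc i))"
  proof (rule dim_quotient_le[OF s(1) subV subV subY subY])
    show "V (Suc i) = {x \<in> V (Suc (Suc i)). s x \<in> Y i}"
    proof (intro equalityI subsetI)
      fix x assume "x \<in> V (Suc i)"
      then show "x \<in> {x \<in> V (Suc (Suc i)). s x \<in> Y i}"
        using mono(1) sV ssV unfolding Y_def by blast
    next
      fix x assume x: "x \<in> {x \<in> V (Suc (Suc i)). s x \<in> Y i}"
      then have "s (s x) \<in> V i" unfolding Y_def by blast
      then have "ev (L ^ i) (ev M (ev L x)) = 0" unfolding V_def ss by (simp add: ev_vec_neg)
      moreover have "ev (L ^ i) (ev M (ev L x)) = ev M (ev (L ^ Suc i) x)"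
        unfolding ev_mult[symmetric] by (simp only: power_Suc mult_ac)
      ultimately have "ev M (ev (L ^ Suc i) x) = 0" by simp
      moreover have "ev L (ev (L ^ Suc i) x) = 0"
        using x unfolding V_def by (simp add: ev_mult)
      ultimately have "ev (L ^ Suc i) x = 0" using ev_comaximal_eq_0[OF co] by blast
      then show "x \<in> V (Suc i)" unfolding V_def by blast
    qed
    show "s ` V (Suc (Suc i)) \<subseteq> Y (Suc i)" using sV ssV unfolding Y_def by blast
    show "Y i \<subseteq> Y (Suc i)" using mono unfolding Y_def by blast
  qed
  moreover have "dim (Y (Suc i)) + dim (W i) \<le> dim (W (Suc i)) + dim (Y i)"
  proof (rule dim_quotient_le[OF linear_ev[of M] subW subY subW subY])
    show "W (Suc i) = {x \<in> Y (Suc i). ev M x \<in> W i}"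
    proof (intro equalityI subsetI)
      fix x assume x: "x \<in> W (Suc i)"
      then have "ev M x \<in> W i" unfolding W_def by (simp add: ev_power_Suc del: power_Suc)
      then show "x \<in> {x \<in> Y (Suc i). ev M x \<in> W i}"
        using x mono(2) sW unfolding Y_def by blast
    next
      fix x assume "x \<in> {x \<in> Y (Suc i). ev M x \<in> W i}"
      then show "x \<in> W (Suc i)" unfolding W_def by (simp add: ev_power_Suc del: power_Suc)
    qed
    show "ev M ` Y (Suc i) \<subseteq> Y i"
    proof (rule image_subsetI)
      fix x assume x: "x \<in> Y (Suc i)"
      have "ev M x \<in> W (Suc i)"
        using x unfolding Y_def W_def by (simp add: ev_power_Suc del: power_Suc)
      moreover have "s (ev M x) = - ev L (s x)"
        by (simp add: M_def L_def s.add s.scale s(2) u.zero)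
      then have "s (ev M x) \<in> V i"
        using x unfolding Y_def V_def by (simp add: ev_power_Suc ev_vec_neg del: power_Suc)
      ultimately show "ev M x \<in> Y i" unfolding Y_def by blast
    qed
    show "W i \<subseteq> Y i" using mono(2) sW unfolding Y_def by blast
  qed
  ultimately show ?thesis
    unfolding ker_jump_def ker_dim_def i V_def W_def L_def M_def by simp
qed

section \<open>Even elementary factors\<close>

lemma operator_square: "operator scale Basis (\<lambda>x. u (u x))"
  by unfold_locales (simp_all add: u.add u.scale)

lemma ev_pcompose_X2: "ev (pcompose P X2) x = poly_endo scale P (\<lambda>x. u (u x)) x"
proof -
  interpret u2: operator scale Basis "\<lambda>x. u (u x)" by (rule operator_square)
  show ?thesis
    by (induction P) (simp_all add: pcompose_pCons monom_altdef power2_eq_square ev_mult)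
qed

text \<open>
If \<open>e\<close> lies in \<open>A\<close>, then \<open>p(u) e\<close> has the component \<open>p\<^sub>0(u\<^sup>2) e\<close> in \<open>A\<close> and the component \<open>u p\<^sub>1(u\<^sup>2) e\<close> in
\<open>B\<close>, where \<open>p = p\<^sub>0(X\<^sup>2) + X p\<^sub>1(X\<^sup>2)\<close>. Hence the \<open>u\<close>-cyclic subspace of \<open>e\<close> is the direct sum of the
\<open>u\<^sup>2\<close>-cyclic one and its image under \<open>u\<close>, and the annihilator \<open>P\<close> of \<open>e\<close> under \<open>u\<^sup>2\<close> becomes \<open>P(X\<^sup>2)\<close>.
\<close>

lemma cyclic_decomposition_square_lift:
  assumes "operator.cyclic_decomposition scale (\<lambda>x. u (u x)) W Ps" "W \<subseteq> A"
    and AB: "subspace A" "subspace B" "A \<inter> B = {0}"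
    and swap: "\<And>x. x \<in> A \<Longrightarrow> u x \<in> B" "\<And>x. x \<in> B \<Longrightarrow> u x \<in> A"
    and inj: "\<And>x. x \<in> A \<Longrightarrow> u x = 0 \<Longrightarrow> x = 0"
  shows "cyclic_decomposition {x + u y | x y. x \<in> W \<and> y \<in> W} (map (\<lambda>P. pcompose P X2) Ps)"
proof -
  interpret u2: operator scale Basis "\<lambda>x. u (u x)" by (rule operator_square)
  have invA: "u2.invariant A" unfolding u2.invariant_def using AB swap by simp
  have uniq: "a = a' \<and> b = b'" if "a \<in> A" "b \<in> A" "a' \<in> A" "b' \<in> A" "a + u b = a' + u b'" for a b a' b'
  proof -
    have "a - a' = u (b' - b)" using that(5) by (simp add: u.diff algebra_simps)
    moreover have "a - a' \<in> A" "b' - b \<in> A" using that AB(1) by (simp_all add: subspace_diff)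
    ultimately have "a - a' \<in> A \<inter> B" "u (b' - b) = a - a'" using swap by auto
    then have "a - a' = 0" "u (b' - b) = 0" using AB(3) by auto
    then show ?thesis using inj[OF \<open>b' - b \<in> A\<close>] by simp
  qed
  have split: "\<exists>a b. \<forall>x. ev p x = u2.ev a x + u (u2.ev b x) \<and> p = pcompose a X2 + [:0, 1:] * pcompose b X2" for p
  proof -
    obtain a b where "p = pcompose a X2 + [:0, 1:] * pcompose b X2" using poly_even_odd_split by blast
    then show ?thesis by (intro exI[of _ a] exI[of _ b]) (simp add: ev_pcompose_X2)
  qed
  show ?thesis using assms(1,2)
  proof (induction rule: u2.cyclic_decomposition.induct)
    case empty
    show ?case by (simp add: u.zero cyclic_decomposition.empty)
  next
    case (snoc W Ps e P W')
    note ds = snoc.hyps(3)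
    have WA: "W \<subseteq> A" and eA: "e \<in> A"
      using direct_sum_subset[OF ds] snoc.prems u2.self_in_cyclic[of e] by auto
    have subW: "subspace W" using ds unfolding direct_sum_def by blast
    have evA: "u2.ev a e \<in> A" for a using u2.invariant_ev[OF invA eA] .
    let ?S = "\<lambda>W. {x + u y | x y. x \<in> W \<and> y \<in> W}"
    have IH: "cyclic_decomposition (?S W) (map (\<lambda>P. pcompose P X2) Ps)"
      using snoc.IH WA by blast
    have "annihilator e (pcompose P X2)"
      unfolding annihilator_def
    proof (intro allI iffI)
      fix p assume p: "ev p e = 0"
      obtain a b where ab: "ev p e = u2.ev a e + u (u2.ev b e)" "p = pcompose a X2 + [:0, 1:] * pcompose b X2"
        using split[of p] by blast
      have "u2.ev a e = 0 \<and> u2.ev b e = 0"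
        using uniq[of "u2.ev a e" "u2.ev b e" 0 0] evA ab(1) p subspace_0[OF AB(1)] by (simp add: u.zero)
      then have "P dvd a" "P dvd b" using snoc.hyps(2) unfolding u2.annihilator_def by auto
      then obtain c d where "a = P * c" "b = P * d" by (auto elim!: dvdE)
      then have "p = pcompose P X2 * (pcompose c X2 + [:0, 1:] * pcompose d X2)"
        unfolding ab(2) by (simp only: pcompose_mult) (simp only: algebra_simps)
      then show "pcompose P X2 dvd p" by (rule dvdI)
    next
      fix p assume "pcompose P X2 dvd p"
      moreover have "ev (pcompose P X2) e = 0"
        using u2.annihilator_self[OF snoc.hyps(2)] by (simp add: ev_pcompose_X2)
      ultimately show "ev p e = 0" by (rule ev_dvd_eq_0)
    qed
    moreover have "direct_sum (?S W') (?S W) (cyclic e)"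
      unfolding direct_sum_def
    proof (intro conjI)
      have "?S W = {x + y | x y. x \<in> W \<and> y \<in> u ` W}" by blast
      then show "subspace (?S W)" using subspace_sums[OF subW u.subspace_image[OF subW]] by simp
      show "subspace (cyclic e)" using invariant_cyclic unfolding invariant_def by blast
      show "?S W \<inter> cyclic e = {0}"
      proof (intro equalityI subsetI)
        fix z assume z: "z \<in> ?S W \<inter> cyclic e"
        then obtain w w' where w: "z = w + u w'" "w \<in> W" "w' \<in> W" by blast
        obtain p where "z = ev p e" using z unfolding cyclic_def by blast
        then obtain a b where ab: "z = u2.ev a e + u (u2.ev b e)" using split[of p] by auto
        have "w = u2.ev a e \<and> w' = u2.ev b e"
          using uniq[of w w' "u2.ev a e" "u2.ev b e"] w ab WA evA by auto
        then have "w \<in> W \<inter> u2.cyclic e" "w' \<in> W \<inter> u2.cyclic e"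
          using w(2,3) u2.cyclicI by auto
        then have "w = 0" "w' = 0" using ds unfolding direct_sum_def by auto
        then show "z \<in> {0}" using w(1) by (simp add: u.zero)
      next
        fix z :: 'e assume "z \<in> {0}"
        then have z0: "z = 0" by simp
        have "0 \<in> cyclic e" using invariant_cyclic subspace_0 unfolding invariant_def by blast
        moreover have "0 \<in> ?S W"
          using subspace_0[OF subW] by (intro CollectI exI[of _ 0]) (simp add: u.zero)
        ultimately show "z \<in> ?S W \<inter> cyclic e" using z0 by simp
      qed
      show "?S W' = {x + y | x y. x \<in> ?S W \<and> y \<in> cyclic e}"
      proof (intro equalityI subsetI)
        fix z assume "z \<in> ?S W'"
        then obtain x y where xy: "z = x + u y" "x \<in> W'" "y \<in> W'" by blast
        obtain w c where wc: "x = w + c" "w \<in> W" "c \<in> u2.cyclic e" using direct_sumE[OF ds xy(2)] by metis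
        obtain w' c' where wc': "y = w' + c'" "w' \<in> W" "c' \<in> u2.cyclic e" using direct_sumE[OF ds xy(3)] by metis
        obtain a where a: "c = u2.ev a e" using wc(3) unfolding u2.cyclic_def by blast
        obtain b where b: "c' = u2.ev b e" using wc'(3) unfolding u2.cyclic_def by blast
        have "z = (w + u w') + ev (pcompose a X2 + [:0, 1:] * pcompose b X2) e"
          unfolding xy(1) wc(1) wc'(1) a b by (simp add: ev_pcompose_X2 u.add)
        moreover have "w + u w' \<in> ?S W" using wc(2) wc'(2) by blast
        moreover have "ev (pcompose a X2 + [:0, 1:] * pcompose b X2) e \<in> cyclic e" by (rule cyclicI)
        ultimately show "z \<in> {x + y | x y. x \<in> ?S W \<and> y \<in> cyclic e}" by blast
      next
        fix z assume "z \<in> {x + y | x y. x \<in> ?S W \<and> y \<in> cyclic e}"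
        then obtain w w' c where w: "z = (w + u w') + c" "w \<in> W" "w' \<in> W" "c \<in> cyclic e" by blast
        obtain p where "c = ev p e" using w(4) unfolding cyclic_def by blast
        then obtain a b where ab: "c = u2.ev a e + u (u2.ev b e)" using split[of p] by auto
        have "z = (w + u2.ev a e) + u (w' + u2.ev b e)" using w(1) ab by (simp add: u.add)
        moreover have "w + u2.ev a e \<in> W'" "w' + u2.ev b e \<in> W'"
          using w(2,3) direct_sum_subset[OF ds] u2.cyclicI[of _ e] subspace_add[OF direct_sum_subspace[OF ds]]
          by blast+
        ultimately show "z \<in> ?S W'" by blast
      qed
    qed
    ultimately show ?case using cyclic_decomposition.snoc[OF IH] by simp
  qed
qed

text \<open>
The values of \<open>Q\<close> at \<open>0\<close>, \<open>a\<close> and \<open>- a\<close> make \<open>u\<close>, \<open>a - u\<close> and \<open>a + u\<close> invertible on the kernel of \<open>Q(u)\<close>. There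
\<open>j = (a + u)\<^sup>-\<^sup>1 s\<close> is an involution that anticommutes with \<open>u\<close>, and \<open>u\<close> maps its eigenspaces \<open>A\<close> and \<open>B\<close>
bijectively onto each other.
\<close>

lemma even_elementary_factors:
  assumes s: "Vector_Spaces.linear scale scale s" "\<And>x. s (u x) = - u (s x)"
    "\<And>x. s (s x) = (a * a) *s x - u (u x)"
    and two: "(2::'k) \<noteq> 0"
    and roots: "poly Q 0 \<noteq> 0" "poly Q a \<noteq> 0" "poly Q (- a) \<noteq> 0"
    and sF: "\<And>x. ev Q x = 0 \<Longrightarrow> ev Q (s x) = 0"
  shows "\<exists>Ps. elementary_factors_on scale {x. ev Q x = 0} u Ps \<and> (\<forall>P\<in>set Ps. even_poly P)"
proof -
  interpret s: Vector_Spaces.linear scale scale s by (rule s(1))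
  interpret u2: operator scale Basis "\<lambda>x. u (u x)" by (rule operator_square)
  let ?F = "{x. ev Q x = 0}"
  have inv: "invariant ?F" by (rule invariant_kernel_ev)
  then have subF: "subspace ?F" and uF: "\<And>x. x \<in> ?F \<Longrightarrow> u x \<in> ?F" unfolding invariant_def by auto
  have co: "comaximal [:0, 1:] Q" "comaximal [:- a, 1:] Q" "comaximal [:a, 1:] Q"
    using comaximal_linear_if_no_root[of Q 0] comaximal_linear_if_no_root[of Q a]
      comaximal_linear_if_no_root[of Q "- a"] roots by simp_all
  have inj0: "x = 0" if "x \<in> ?F" "u x = 0" for x
    using ev_comaximal_eq_0[OF co(1), of x] that by (simp add: u.zero)
  have injm: "x = 0" if "x \<in> ?F" "a *s x - u x = 0" for x
    using ev_comaximal_eq_0[OF co(2), of x] that by (simp add: u.zero)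
  have injp: "x = y" if "x \<in> ?F" "y \<in> ?F" "a *s x + u x = a *s y + u y" for x y
  proof -
    have "ev [:a, 1:] (x - y) = 0" using that(3) by (simp add: u.zero u.diff scale_right_diff_distrib algebra_simps)
    moreover have "ev Q (x - y) = 0" using that(1,2) by (simp add: ev_vec_diff)
    ultimately have "x - y = 0" using ev_comaximal_eq_0[OF co(3)] by blast
    then show ?thesis by simp
  qed
  obtain r where "\<And>x. ev Q x = 0 \<Longrightarrow> ev [:a, 1:] (ev r x) = x" using comaximal_inverse[OF co(3)] by blast
  then have r: "\<And>x. x \<in> ?F \<Longrightarrow> a *s ev r x + u (ev r x) = x" by (simp add: u.zero)
  obtain t where "\<And>x. ev Q x = 0 \<Longrightarrow> ev [:0, 1:] (ev t x) = x" using comaximal_inverse[OF co(1)] by blast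
  then have t: "\<And>x. x \<in> ?F \<Longrightarrow> u (ev t x) = x" by (simp add: u.zero)
  define j where "j x = ev r (s x)" for x
  have jF: "j x \<in> ?F" if "x \<in> ?F" for x
    unfolding j_def using invariant_ev[OF inv, of "s x"] sF that by blast
  have j_add: "j (x + y) = j x + j y" and j_scale: "j (c *s x) = c *s j x" for x y c
    unfolding j_def by (simp_all add: s.add s.scale ev_vec_add ev_vec_scale)
  have j_neg: "j (- x) = - j x" for x using j_scale[of "- 1" x] by simp
  have j_diff: "j (x - y) = j x - j y" for x y using j_add[of x "- y"] j_neg[of y] by simp
  have aj: "a *s j x + u (j x) = s x" if "x \<in> ?F" for x
    unfolding j_def using r[of "s x"] sF that by simp
  have ju: "j (u x) = - u (j x)" if x: "x \<in> ?F" for x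
  proof (rule injp)
    show "j (u x) \<in> ?F" using jF uF x by blast
    show "- u (j x) \<in> ?F" using jF uF x subspace_neg[OF subF] by blast
    have "a *s j (u x) + u (j (u x)) = - u (a *s j x + u (j x))"
      unfolding aj[OF uF[OF x]] aj[OF x] by (rule s(2))
    then show "a *s j (u x) + u (j (u x)) = a *s - u (j x) + u (- u (j x))"
      by (simp add: u.add u.scale u.neg)
  qed
  have jj: "j (j x) = x" if x: "x \<in> ?F" for x
  proof -
    define z where "z = j (j x) - x"
    have z: "z \<in> ?F" unfolding z_def using jF x subspace_diff[OF subF] by blast
    have "s (s x) = s (a *s j x + u (j x))" unfolding aj[OF x] ..
    also have "\<dots> = a *s s (j x) - u (s (j x))" by (simp add: s.add s.scale s(2))
    also have "\<dots> = a *s (a *s j (j x) + u (j (j x))) - u (a *s j (j x) + u (j (j x)))"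
      unfolding aj[OF jF[OF x]] ..
    finally have "(a * a) *s z - u (u z) = 0"
      unfolding z_def s(3) by (simp add: u.add u.scale u.diff scale_right_distrib scale_right_diff_distrib algebra_simps)
    then have 0: "a *s (a *s z + u z) - u (a *s z + u z) = 0"
      by (simp add: u.add u.scale scale_right_distrib)
    have "a *s z + u z \<in> ?F" using z uF subspace_add[OF subF] subspace_scale[OF subF] by blast
    then have "a *s z + u z = 0" using 0 by (rule injm)
    then have "z = 0" using injp[OF z subspace_0[OF subF]] by (simp add: u.zero)
    then show ?thesis unfolding z_def by simp
  qed
  define A where "A = {x \<in> ?F. j x = x}"
  define B where "B = {x \<in> ?F. j x = - x}"
  have j0: "j 0 = 0" using j_scale[of 0 0] by simp
  have subA: "subspace A" and subB: "subspace B"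
    using subspace_0[OF subF] subspace_add[OF subF] subspace_scale[OF subF]
    unfolding A_def B_def by (auto simp: subspace_def j_add j_scale j0)
  have half: "x = 0" if "x = - x" for x :: 'e
  proof -
    have "2 *s x = x + x" using scale_left_distrib[of 1 1 x] by simp
    also have "\<dots> = x + - x" using arg_cong[OF that, of "(+) x"] .
    also have "\<dots> = 0" by simp
    finally show ?thesis using two by simp
  qed
  have AB: "A \<inter> B = {0}"
  proof (intro equalityI subsetI)
    fix x assume "x \<in> A \<inter> B"
    then have "x = - x" unfolding A_def B_def by auto
    then show "x \<in> {0}" using half by blast
  qed (use subspace_0[OF subA] subspace_0[OF subB] in simp)
  have uA: "u x \<in> B" if "x \<in> A" for x
    using that uF ju unfolding A_def B_def by auto
  have uB: "u x \<in> A" if "x \<in> B" for x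
    using that uF ju unfolding A_def B_def by (auto simp: u.neg)
  have "u2.invariant A" unfolding u2.invariant_def using subA uA uB by blast
  then obtain Ps where Ps: "u2.cyclic_decomposition A Ps" "sorted_wrt (dvd) Ps"
    "\<And>P. P \<in> set Ps \<Longrightarrow> lead_coeff P = 1 \<and> degree P > 0"
    using u2.exists_invariant_factors by blast
  let ?Ps = "map (\<lambda>P. pcompose P X2) Ps"
  have inA: "x = 0" if "x \<in> A" "u x = 0" for x using inj0 that unfolding A_def by blast
  have "cyclic_decomposition {x + u y | x y. x \<in> A \<and> y \<in> A} ?Ps"
    by (rule cyclic_decomposition_square_lift[OF Ps(1) order_refl subA subB AB uA uB inA])
  moreover have "{x + u y | x y. x \<in> A \<and> y \<in> A} = ?F"
  proof (intro equalityI subsetI)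
    fix z assume "z \<in> {x + u y | x y. x \<in> A \<and> y \<in> A}"
    then obtain x y where "z = x + u y" "x \<in> ?F" "y \<in> ?F" unfolding A_def by blast
    then show "z \<in> ?F" using uF subspace_add[OF subF] by blast
  next
    fix z assume z: "z \<in> ?F"
    define h where "h = inverse (2::'k)"
    have h: "h + h = 1" using two unfolding h_def by (simp add: mult_2[symmetric])
    \<comment> \<open>The components of \<open>z\<close> in \<open>A\<close> and \<open>B\<close>; the second one is then written as \<open>u y\<close> with \<open>y\<close> in \<open>A\<close>.\<close>
    define x where "x = h *s (z + j z)"
    define w where "w = h *s (z - j z)"
    have wF: "w \<in> ?F" and xF: "x \<in> ?F"
      unfolding w_def x_def using z jF[OF z] subspace_add[OF subF] subspace_diff[OF subF] subspace_scale[OF subF] by blast+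
    have xA: "x \<in> A" unfolding A_def using xF jj[OF z] by (simp add: x_def j_add j_scale add.commute)
    have jw: "j w = - w"
      using jj[OF z] by (simp add: w_def j_diff j_scale scale_right_diff_distrib)
    define y where "y = ev t w"
    have yF: "y \<in> ?F" unfolding y_def using invariant_ev[OF inv wF] .
    have uy: "u y = w" unfolding y_def using t[OF wF] .
    have "u (j y - y) = 0" using ju[OF yF] jw uy by (simp add: u.diff)
    then have "j y - y = 0" using inj0 jF[OF yF] yF subspace_diff[OF subF] by blast
    then have yA: "y \<in> A" unfolding A_def using yF by simp
    have "x + w = (h + h) *s z"
      unfolding x_def w_def scale_left_distrib by (simp add: scale_right_distrib scale_right_diff_distrib)
    then have "z = x + u y" using uy h by simp
    then show "z \<in> {x + u y | x y. x \<in> A \<and> y \<in> A}" using xA yA by blast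
  qed
  ultimately have dec: "cyclic_decomposition ?F ?Ps" by simp
  have monic: "lead_coeff P = 1 \<and> degree P > 0" if P: "P \<in> set ?Ps" for P
  proof -
    obtain R where R: "R \<in> set Ps" "P = pcompose R X2" using P by auto
    have "lead_coeff P = lead_coeff R * lead_coeff X2 ^ degree R"
      unfolding R(2) by (rule lead_coeff_comp) (simp add: degree_monom_eq)
    then show ?thesis using Ps(3)[OF R(1)] R(2) by (simp add: degree_pcompose degree_monom_eq)
  qed
  moreover have "sorted_wrt (dvd) ?Ps"
    unfolding sorted_wrt_map by (rule sorted_wrt_mono_rel[OF _ Ps(2)]) (rule pcompose_dvd)
  ultimately have "elementary_factors_on scale ?F u ?Ps"
    unfolding elementary_factors_on_def using cyclic_decomposition_represented[OF dec] by blast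
  moreover have "\<forall>P\<in>set ?Ps. even_poly P" unfolding even_poly_def polynomial_of_def by auto
  ultimately show ?thesis by blast
qed

section \<open>Difference of two idempotents\<close>

text \<open>
The number of all linear factors split off from the minimal polynomial serves as a common exponent \<open>N\<close>
for the three roots.
\<close>

lemma primary_decomposition:
  assumes a: "a \<noteq> 0" "(2::'k) \<noteq> 0"
  defines "Q \<equiv> rootless_part {0, a, - a} (min_poly scale u)"
  obtains N where "poly Q 0 \<noteq> 0" "poly Q a \<noteq> 0" "poly Q (- a) \<noteq> 0"
    "\<And>x. ev (([:0, 1:] ^ N * ([:- a, 1:] ^ N * [:a, 1:] ^ N)) * Q) x = 0"
    "comaximal ([:0, 1:] ^ N * ([:- a, 1:] ^ N * [:a, 1:] ^ N)) Q"
    "comaximal ([:0, 1:] ^ N) ([:- a, 1:] ^ N * [:a, 1:] ^ N)"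
    "comaximal ([:- a, 1:] ^ N) ([:a, 1:] ^ N)"
proof -
  let ?X = "[:0, 1:] :: 'k poly" and ?L = "[:- a, 1:]" and ?M = "[:a, 1:]"
  obtain ls where ls: "set ls \<subseteq> {0, a, - a}" "min_poly scale u = (\<Prod>l\<leftarrow>ls. [:- l, 1:]) * Q"
    "\<forall>l\<in>{0, a, - a}. poly Q l \<noteq> 0"
    using rootless_partE[OF min_poly_props(1), of "{0, a, - a}"] unfolding Q_def by blast
  let ?N = "length ls"
  have "2 * a \<noteq> 0" using a by simp
  then have aa: "a + a \<noteq> 0" "- a + - a \<noteq> 0" by (simp_all add: mult_2[symmetric])
  have XQ: "comaximal ?X Q" "comaximal ?L Q" "comaximal ?M Q"
    using comaximal_linear_if_no_root[of Q 0] comaximal_linear_if_no_root[of Q a]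
      comaximal_linear_if_no_root[of Q "- a"] ls(3) by simp_all
  have XL: "comaximal ?X ?L" "comaximal ?X ?M" "comaximal ?L ?M"
    using comaximal_linear_if_no_root[of ?L 0] comaximal_linear_if_no_root[of ?M 0]
      comaximal_linear_if_no_root[of ?M a] a aa by simp_all
  have pow: "comaximal (P ^ ?N) R" if "comaximal P R" for P R :: "'k poly"
    using comaximal_power[OF that, of ?N 1] by simp
  have "comaximal Q (?X ^ ?N * (?L ^ ?N * ?M ^ ?N))"
    by (intro comaximal_mult) (simp_all add: comaximal_sym[OF pow] XQ)
  then have 1: "comaximal (?X ^ ?N * (?L ^ ?N * ?M ^ ?N)) Q" by (rule comaximal_sym)
  have 2: "comaximal (?X ^ ?N) (?L ^ ?N * ?M ^ ?N)"
    by (intro comaximal_mult comaximal_power XL)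
  have 3: "comaximal (?L ^ ?N) (?M ^ ?N)" by (intro comaximal_power XL)
  have "[:- l, 1:] dvd ?X * (?L * ?M)" if "l \<in> {0, a, - a}" for l
  proof -
    have "[:- l, 1:] = ?X \<or> [:- l, 1:] = ?L \<or> [:- l, 1:] = ?M" using that by auto
    then show ?thesis
      by (elim disjE) (simp_all only: dvd_triv_left dvd_mult dvd_triv_right)
  qed
  then have "(\<Prod>l\<leftarrow>ls. [:- l, 1:]) dvd (?X * (?L * ?M)) ^ ?N"
    by (rule prod_list_linear_dvd_power[OF ls(1)])
  then have "min_poly scale u dvd (?X ^ ?N * (?L ^ ?N * ?M ^ ?N)) * Q"
    unfolding ls(2) power_mult_distrib by (rule mult_dvd_mono) simp
  then have "ev ((?X ^ ?N * (?L ^ ?N * ?M ^ ?N)) * Q) x = 0" for x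
    using ev_dvd_eq_0 min_poly_props(2) by blast
  then show ?thesis using that[of ?N] 1 2 3 ls(3) by blast
qed


theorem composite_iff_intertwined_and_even:
  assumes a: "a \<noteq> 0" "(2::'k) \<noteq> 0"
  shows "composite scale a (- a) u \<longleftrightarrow>
    intertwined (n_seq scale u a) (n_seq scale u (- a)) \<and>
    (\<exists>Ps. elementary_factors_on scale (off_space scale u {0, a, - a}) u Ps \<and> (\<forall>P\<in>set Ps. even_poly P))"
proof -
  define Q where "Q = rootless_part {0, a, - a} (min_poly scale u)"
  let ?X = "[:0, 1:] :: 'k poly" and ?L = "[:- a, 1:]" and ?M = "[:a, 1:]"
  let ?F = "{x. ev Q x = 0}"
  have F: "off_space scale u {0, a, - a} = ?F"
    unfolding off_space_def kernel_def Q_def ..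
  obtain N where Q: "poly Q 0 \<noteq> 0" "poly Q a \<noteq> 0" "poly Q (- a) \<noteq> 0"
    and kill: "\<And>x. ev ((?X ^ N * (?L ^ N * ?M ^ N)) * Q) x = 0"
    and co: "comaximal (?X ^ N * (?L ^ N * ?M ^ N)) Q" "comaximal (?X ^ N) (?L ^ N * ?M ^ N)"
      "comaximal (?L ^ N) (?M ^ N)"
    using primary_decomposition[OF a] unfolding Q_def by blast
  show ?thesis
  proof
    assume "composite scale a (- a) u"
    then have "anticommuting_root (a * a) UNIV" using composite_iff_anticommuting_root[OF a] by simp
    then obtain s where s: "Vector_Spaces.linear scale scale s"
      "\<And>x. s (u x) = - u (s x)" "\<And>x. s (s x) = (a * a) *s x - u (u x)"
      unfolding anticommuting_root_def by auto
    have s': "s (s x) = (- a * - a) *s x - u (u x)" for x using s(3) by simp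
    have "intertwined (n_seq scale u a) (n_seq scale u (- a))"
      unfolding intertwined_def n_seq_eq_ker_jump
      using anticommuting_root_ker_jump_le[OF s a]
        anticommuting_root_ker_jump_le[OF s(1,2) s' _ a(2)] a(1) by simp
    \<comment> \<open>The kernel of \<open>Q(u)\<close> is the range of \<open>T(u)\<^sup>N\<close> with the odd polynomial \<open>T = X (X\<^sup>2 - a\<^sup>2)\<close>, and \<open>s\<close> maps
      this range to itself because it commutes with \<open>T(u)\<close> up to sign.\<close>
    moreover have "ev Q (s x) = 0" if x: "ev Q x = 0" for x
    proof -
      let ?S = "?X ^ N * (?L ^ N * ?M ^ N)"
      have S: "?S = (?X * (?L * ?M)) ^ N" by (simp only: power_mult_distrib)
      have "reflect (?X * (?L * ?M)) = - (?X * (?L * ?M))"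
        by (simp add: pcompose_pCons)
      then have "?S dvd reflect ?S" unfolding S by (rule reflect_power_odd)
      then obtain R where R: "reflect ?S = ?S * R" by blast
      obtain r where r: "\<And>x. ev Q x = 0 \<Longrightarrow> ev ?S (ev r x) = x"
        using comaximal_inverse[OF co(1)] by blast
      have "ev ?S (ev r x) = x" using x by (rule r)
      moreover have "invariant UNIV" unfolding invariant_def by simp
      then have "s (ev ?S (ev r x)) = ev (reflect ?S) (s (ev r x))"
        using s(1,2) by (intro anticommute_ev) auto
      ultimately have "ev Q (s x) = ev Q (ev ?S (ev R (s (ev r x))))" unfolding R by (simp only: ev_mult)
      also have "\<dots> = ev (?S * Q) (ev R (s (ev r x)))"
        unfolding ev_mult[of ?S Q] by (rule ev_commute)
      also have "\<dots> = 0" by (rule kill)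
      finally show ?thesis .
    qed
    then have "\<exists>Ps. elementary_factors_on scale ?F u Ps \<and> (\<forall>P\<in>set Ps. even_poly P)"
      by (rule even_elementary_factors[OF s a(2) Q])
    ultimately show "intertwined (n_seq scale u a) (n_seq scale u (- a)) \<and>
      (\<exists>Ps. elementary_factors_on scale (off_space scale u {0, a, - a}) u Ps \<and> (\<forall>P\<in>set Ps. even_poly P))"
      unfolding F by blast
  next
    assume "intertwined (n_seq scale u a) (n_seq scale u (- a)) \<and>
      (\<exists>Ps. elementary_factors_on scale (off_space scale u {0, a, - a}) u Ps \<and> (\<forall>P\<in>set Ps. even_poly P))"
    then obtain Ps where int: "intertwined (n_seq scale u a) (n_seq scale u (- a))"
      and Ps: "represented_on scale ?F u (diag_block_mat (map companion_mat Ps))" "\<And>P. P \<in> set Ps \<Longrightarrow> even_poly P"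
      unfolding F elementary_factors_on_def by blast
    have rF: "anticommuting_root (a * a) ?F"
      by (rule anticommuting_root_of_parity[OF Ps(1)])
        (rule even_poly_parity[OF Ps(2) less_imp_le])
    let ?V = "{x. ev (?L ^ N) x = 0}" and ?W = "{x. ev (?M ^ N) x = 0}"
    \<comment> \<open>Since \<open>X - b\<close> is comaximal with the remaining factor, no vector outside \<open>Ker (u - b)\<^sup>N\<close>
      is killed by a higher power of \<open>u - b\<close>, and the jumps may be computed inside this kernel.\<close>
    have stable: "ker_jump b {x. ev (P ^ N) x = 0} k = ker_jump b UNIV k"
      if "comaximal P R" "\<And>x. ev (P ^ N * R) x = 0" "P = [:- b, 1:]" for P R b k
    proof -
      have "ev (P ^ N) x = 0" if "ev (P ^ k) x = 0" for x k
      proof (rule ev_comaximal_eq_0)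
        show "comaximal (P ^ k) R" using comaximal_power[OF \<open>comaximal P R\<close>, of k 1] by simp
        show "ev (P ^ k) (ev (P ^ N) x) = 0" using that by (simp add: ev_commute[of "P ^ k"])
        show "ev R (ev (P ^ N) x) = 0"
          using \<open>\<And>x. ev (P ^ N * R) x = 0\<close> by (simp add: ev_commute[of R] ev_mult)
      qed
      then have "{x. ev (P ^ N) x = 0} \<inter> {x. ev (P ^ k) x = 0} = UNIV \<inter> {x. ev (P ^ k) x = 0}" for k
        by blast
      then show ?thesis unfolding ker_jump_def ker_dim_def that(3) by simp
    qed
    have "2 * a \<noteq> 0" using a by simp
    then have aa: "a + a \<noteq> 0" "- a + - a \<noteq> 0" by (simp_all add: mult_2[symmetric])
    have LR: "comaximal ?L (?X ^ N * ?M ^ N * Q)"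
      using a Q aa by (intro comaximal_linear_if_no_root) (simp add: poly_power)
    have MR: "comaximal ?M (?X ^ N * ?L ^ N * Q)"
      using a Q aa comaximal_linear_if_no_root[of "?X ^ N * ?L ^ N * Q" "- a"] by (simp add: poly_power)
    have stV: "ker_jump a ?V k = ker_jump a UNIV k" for k
      using kill by (intro stable[OF LR]) (simp_all add: mult_ac)
    have stW: "ker_jump (- a) ?W k = ker_jump (- a) UNIV k" for k
      using kill by (intro stable[OF MR]) (simp_all add: mult_ac)
    have "anticommuting_root (a * a) {x. ev (?L ^ N * ?M ^ N) x = 0}"
    proof (rule anticommuting_root_intertwined[OF invariant_kernel_ev invariant_kernel_ev direct_sum_kernels[OF co(3)]])
      fix k :: nat assume "k \<ge> 1"
      then show "ker_jump a ?V (k + 1) \<le> ker_jump (- a) ?W k" "ker_jump (- a) ?W (k + 1) \<le> ker_jump a ?V k"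
        using int unfolding intertwined_def n_seq_eq_ker_jump stV stW by simp_all
    qed blast+
    moreover have "anticommuting_root (a * a) {x. ev (?X ^ N) x = 0}"
      by (rule anticommuting_root_nilpotent[OF invariant_kernel_ev]) blast
    ultimately have "anticommuting_root (a * a) {x. ev (?X ^ N * (?L ^ N * ?M ^ N)) x = 0}"
      using anticommuting_root_direct_sum[OF _ _ direct_sum_kernels[OF co(2)]] by blast
    then have "anticommuting_root (a * a) {x. ev ((?X ^ N * (?L ^ N * ?M ^ N)) * Q) x = 0}"
      using anticommuting_root_direct_sum[OF _ rF direct_sum_kernels[OF co(1)]] by blast
    moreover have "{x. ev ((?X ^ N * (?L ^ N * ?M ^ N)) * Q) x = 0} = UNIV" using kill by blast
    ultimately show "composite scale a (- a) u" using composite_iff_anticommuting_root[OF a] by simp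
  qed
qed

end

theorem theorem2:
  fixes scale :: "'k::field \<Rightarrow> 'e::ab_group_add \<Rightarrow> 'e"
    and Basis :: "'e set"
    and n :: nat
    and \<alpha> :: 'k
    and u :: "'e \<Rightarrow> 'e"
  assumes "CHAR('k) \<noteq> 2"
    and "\<alpha> \<noteq> 0"
    and "finite_dimensional_vector_space scale Basis"
    and "vector_space.dim scale (UNIV :: 'e set) = n"
    and "n \<ge> 1"
    and "Vector_Spaces.linear scale scale u"
  shows "composite scale \<alpha> (- \<alpha>) u \<longleftrightarrow>
    intertwined (n_seq scale u \<alpha>) (n_seq scale u (- \<alpha>)) \<and>
    (\<exists>Ps. elementary_factors_on scale (off_space scale u {0, \<alpha>, - \<alpha>}) u Ps \<and>
          (\<forall>P\<in>set Ps. even_poly P))"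
proof -
  interpret operator scale Basis u
    using assms(3,6) by (intro operator.intro operator_axioms.intro)
  have "(2::'k) \<noteq> 0"
  proof
    assume "(2::'k) = 0"
    then have "CHAR('k) dvd 2" using of_nat_eq_0_iff_char_dvd[where 'a = 'k, of 2] by simp
    then have "CHAR('k) = 1 \<or> CHAR('k) = 2" using prime_nat_iff two_is_prime_nat by blast
    then show False using assms(1) CHAR_not_1'[where 'a = 'k] by simp
  qed
  then show ?thesis using composite_iff_intertwined_and_even assms(2) by blast
qed

end
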